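(* For every edge-breaking $c3$-lopsp-operation $O$, there exist simple 3-connected embedded graphs $G$ of arbitrary genus $>0$ such that the (multi)graph $O(G)$ is not 3-connected; that is, for every edge-breaking $c3$-lopsp-operation $O$ and every integer $g\ge 1$ there exists a simple 3-connected embedded graph $G$ of genus $g$ such that $O(G)$ is not 3-connected.
   Context: Graphs are finite and may have loops and multiple edges; a graph is simple if it has neither. An embedded graph is a connected graph with at least one edge together with a rotation system: each edge has two oriented edges $e,e^{-1}$, one for each of its end vertices (the associated vertex), and $\sigma$ is a permutation of the oriented edges inducing a cyclic ordering of the oriented edges at each vertex. Faces (facial walks) are the orbits of $e\mapsto\sigma(e^{-1})$. The genus is $(2-|V_G|+|E_G|-|F_G|)/2$; plane means genus $0$. A graph is 3-connected if it has at least four vertices and no vertex-cut of fewer than three vertices. Barycentric subdivision: $B_G$ is the embedded graph of the same genus as $G$ with vertex set $V_G\cup E_G\cup F_G$ (vertices of type $0,1,2$ respectively), obtained by placing a vertex in each edge and in each face: there is one edge between $v\in V_G$ and $e\in E_G$ per incidence, one between $e$ and $f\in F_G$ per occurrence of $e$ in the facial walk $f$, and one between $v$ and $f$ per occurrence of $v$ in the facial walk $f$. All faces are triangles with one vertex of each type. An edge is of type $i$ if neither endpoint has type $i$. $D_G$ is obtained from $B_G$ by deleting the type-0 edges; its faces are the double chambers (two per edge of $G$). A lopsp-operation is a 2-connected plane embedded multigraph $O$ with a labelling $t:V_O\to\{0,1,2\}$ ("type") and three special vertices $v_0,v_1,v_2$ such that: (1) every face is a triangle; (2) no edge joins vertices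 of the same type; (3) $t(v_0),t(v_2)\neq 1$; $t(v_1)=1$ implies $\deg(v_1)=2$; and every vertex $v\ne v_0,v_1,v_2$ with $t(v)=1$ has $\deg(v)=4$. Application: a cut-path $P$ is a simple path in $O$ from $v_1$ to $v_2$ containing $v_0$. Cutting $O$ open along $P$ gives the double chamber patch $O_P$, a plane graph whose outer boundary consists of two copies of $P$ sharing $v_1$ and $v_2$, with two copies $v_{0,L},v_{0,R}$ of $v_0$. For an embedded graph $G$, replace each type-1 edge of $D_G$ by a copy of the subpath $P_{v_0,v_2}$ and each type-2 edge by a copy of $P_{v_0,v_1}$ (a vertex of $D_G$ of type $j$ being identified with the copy of $v_j$) and glue a copy of $O_P$, with consistent orientation, into every face. The result, with the types inherited from $O$, is the barycentric subdivision $B_{O(G)}$ of an embedded (multi)graph $O(G)$, which does not depend on $P$. A polyhedral embedding is a 3-connected embedded graph in which every facial walk is a cycle and the intersection of any two faces is empty, one vertex or one edge. A lopsp-operation $O$ is $c3$ if $O(G)$ is a polyhedral embedding for every polyhedral embedding $G$. $O$ is edge-breaking if $v_1$ and $v_2$ are adjacent in $O$ and $v_2$ is of type $0$. *)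

theory Defs
  imports Complex_Main "Graph_Theory.Graph_Theory"
begin

section \<open>Embedded graphs\<close>

text \<open>
  A multigraph, possibly with loops, is a bidirected digraph: every edge is a pair of mutually
  inverse arcs (its two oriented edges), and the vertex associated with an oriented edge is its
  tail. A loop also consists of two arcs. \<open>einv\<close> is the inversion of oriented edges,
  \<open>rot\<close> is the rotation system.
\<close>

record ('v, 'e) emb =
  skel :: "('v, 'e) pre_digraph"
  einv :: "'e \<Rightarrow> 'e"
  rot :: "'e \<Rightarrow> 'e"

abbreviation everts :: "('v, 'e) emb \<Rightarrow> 'v set" where
  "everts G \<equiv> verts (skel G)"

abbreviation earcs :: "('v, 'e) emb \<Rightarrow> 'e set" where
  "earcs G \<equiv> arcs (skel G)"

abbreviation etail :: "('v, 'e) emb \<Rightarrow> 'e \<Rightarrow> 'v" where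
  "etail G \<equiv> tail (skel G)"

abbreviation ehead :: "('v, 'e) emb \<Rightarrow> 'e \<Rightarrow> 'v" where
  "ehead G \<equiv> head (skel G)"

definition embedded_graph :: "('v, 'e) emb \<Rightarrow> bool" where
  "embedded_graph G \<longleftrightarrow>
     fin_digraph (skel G) \<and> bidirected_digraph (skel G) (einv G) \<and>
     connected (skel G) \<and> earcs G \<noteq> {} \<and>
     rot G permutes earcs G \<and>
     (\<forall>v \<in> everts G. cyclic_on (rot G) (out_arcs (skel G) v))"

definition edges :: "('v, 'e) emb \<Rightarrow> 'e set set" where
  "edges G = (\<lambda>e. {e, einv G e}) ` earcs G"

definition face_succ :: "('v, 'e) emb \<Rightarrow> 'e \<Rightarrow> 'e" where
  "face_succ G = rot G \<circ> einv G"

definition faces :: "('v, 'e) emb \<Rightarrow> 'e set set" where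
  "faces G = orbit (face_succ G) ` earcs G"

definition genus :: "('v, 'e) emb \<Rightarrow> real" where
  "genus G = (2 - real (card (everts G)) + real (card (edges G)) - real (card (faces G))) / 2"

definition k_connected :: "nat \<Rightarrow> ('v, 'e) pre_digraph \<Rightarrow> bool" where
  "k_connected k H \<longleftrightarrow>
     card (verts H) \<ge> k + 1 \<and>
     (\<forall>S \<subseteq> verts H. card S < k \<longrightarrow> connected (H \<restriction> (verts H - S)))"


section \<open>Polyhedral embeddings\<close>

definition face_verts :: "('v, 'e) emb \<Rightarrow> 'e set \<Rightarrow> 'v set" where
  "face_verts G f = etail G ` f"

definition face_edges :: "('v, 'e) emb \<Rightarrow> 'e set \<Rightarrow> 'e set set" where
  "face_edges G f = (\<lambda>e. {e, einv G e}) ` f"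

text \<open>
  A facial walk is given by the set of its oriented edges. It is a cycle if it repeats neither a
  vertex nor an edge; the second condition matters only for walks of length two.
\<close>

definition face_is_cycle :: "('v, 'e) emb \<Rightarrow> 'e set \<Rightarrow> bool" where
  "face_is_cycle G f \<longleftrightarrow> inj_on (etail G) f \<and> inj_on (\<lambda>e. {e, einv G e}) f"

definition faces_meet_properly :: "('v, 'e) emb \<Rightarrow> 'e set \<Rightarrow> 'e set \<Rightarrow> bool" where
  "faces_meet_properly G f f' \<longleftrightarrow>
     (let V = face_verts G f \<inter> face_verts G f'; E = face_edges G f \<inter> face_edges G f' in
        V = {} \<and> E = {} \<or>
        (\<exists>v. V = {v} \<and> E = {}) \<or>
        (\<exists>e \<in> earcs G. V = {etail G e, ehead G e} \<and> E = {{e, einv G e}}))"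

definition polyhedral_embedding :: "('v, 'e) emb \<Rightarrow> bool" where
  "polyhedral_embedding G \<longleftrightarrow>
     embedded_graph G \<and> k_connected 3 (skel G) \<and>
     (\<forall>f \<in> faces G. face_is_cycle G f) \<and>
     (\<forall>f \<in> faces G. \<forall>f' \<in> faces G. f \<noteq> f' \<longrightarrow> faces_meet_properly G f f')"


section \<open>Lopsp-operations\<close>

record ('v, 'e) lopsp =
  patch :: "('v, 'e) emb"
  vtype :: "'v \<Rightarrow> nat"
  sv0 :: 'v
  sv1 :: 'v
  sv2 :: 'v

definition lopsp_operation :: "('v, 'e) lopsp \<Rightarrow> bool" where
  "lopsp_operation Op \<longleftrightarrow>
     (let K = patch Op; t = vtype Op in
        embedded_graph K \<and> genus K = 0 \<and> k_connected 2 (skel K) \<and>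
        t ` everts K \<subseteq> {0, 1, 2} \<and>
        {sv0 Op, sv1 Op, sv2 Op} \<subseteq> everts K \<and> distinct [sv0 Op, sv1 Op, sv2 Op] \<and>
        (\<forall>f \<in> faces K. card f = 3) \<and>
        (\<forall>e \<in> earcs K. t (etail K e) \<noteq> t (ehead K e)) \<and>
        t (sv0 Op) \<noteq> 1 \<and> t (sv2 Op) \<noteq> 1 \<and>
        (t (sv1 Op) = 1 \<longrightarrow> out_degree (skel K) (sv1 Op) = 2) \<and>
        (\<forall>v \<in> everts K - {sv0 Op, sv1 Op, sv2 Op}.
           t v = 1 \<longrightarrow> out_degree (skel K) v = 4))"

definition edge_breaking :: "('v, 'e) lopsp \<Rightarrow> bool" where
  "edge_breaking Op \<longleftrightarrow>
     sv1 Op \<rightarrow>\<^bsub>skel (patch Op)\<^esub> sv2 Op \<and> vtype Op (sv2 Op) = 0"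

text \<open>
  A cut-path is given as the pair of its subpaths from \<open>v\<^sub>1\<close> to \<open>v\<^sub>0\<close> and from \<open>v\<^sub>0\<close> to \<open>v\<^sub>2\<close>.
\<close>

definition cut_path :: "('v, 'e) lopsp \<Rightarrow> 'e list \<times> 'e list \<Rightarrow> bool" where
  "cut_path Op P \<longleftrightarrow>
     (let K = skel (patch Op) in
        pre_digraph.awalk K (sv1 Op) (fst P) (sv0 Op) \<and>
        pre_digraph.awalk K (sv0 Op) (snd P) (sv2 Op) \<and>
        pre_digraph.apath K (sv1 Op) (fst P @ snd P) (sv2 Op))"


section \<open>Applying a lopsp-operation\<close>

text \<open>
  Draw rotations clockwise, so that the face whose facial walk contains an oriented edge lies on
  the left of that oriented edge. There is exactly one double chamber for each oriented edge
  \<open>d = (x, y)\<close> of \<open>G\<close>: its corners are \<open>x\<close>, \<open>y\<close>, the edge of \<open>d\<close>, and the face \<open>f\<close> on the left of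
  \<open>d\<close>. Hence the oriented edges of the graph glued from one copy of the patch for every double
  chamber are the pairs \<open>(d, a)\<close> with \<open>a\<close> an oriented edge of the operation, where \<open>(d, a)\<close> is taken
  to lie in the facial walk of the copy, inside \<open>d\<close>, of the face on the left of \<open>a\<close>.

  The faces of the copies of the patch are kept, so the facial walk goes from \<open>(d, a)\<close> to
  \<open>(d, face_succ a)\<close>. The inverse of \<open>(d, a)\<close> is \<open>(d', a\<^sup>-\<^sup>1)\<close>, with \<open>d' = d\<close> unless \<open>a\<close> lies on the
  cut-path. Walking around the patch with its interior on the left, one meets \<open>v\<^sub>1\<close>, the copy of
  \<open>v\<^sub>0\<close> on the left of the cut-path, \<open>v\<^sub>2\<close>, and the copy of \<open>v\<^sub>0\<close> on the right; around the double
  chamber one meets its edge, \<open>y\<close>, \<open>f\<close>, and \<open>x\<close>. So the copies on the left and on the right of the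
  path go to the sides at \<open>y\<close> and at \<open>x\<close>. Both sides at the edge of \<open>d\<close> are shared with the double
  chamber of \<open>d\<^sup>-\<^sup>1\<close>; the side from \<open>y\<close> to \<open>f\<close> is shared with that of the successor of \<open>d\<close> in the
  facial walk \<open>f\<close>, and the side from \<open>x\<close> to \<open>f\<close> with that of its predecessor.
\<close>

definition neighbour_chamber ::
    "('w, 'b) lopsp \<Rightarrow> 'b list \<times> 'b list \<Rightarrow> ('v, 'e) emb \<Rightarrow> 'b \<Rightarrow> 'e \<Rightarrow> 'e" where
  "neighbour_chamber Op P G a d =
     (let a' = einv (patch Op) a in
        if a \<in> set (fst P) \<or> a' \<in> set (fst P) then einv G d
        else if a \<in> set (snd P) then face_succ G d
        else if a' \<in> set (snd P) then inv (face_succ G) d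
        else d)"

text \<open>
  An embedded graph is determined by its inversion and its facial walks: the rotation is
  \<open>\<sigma> = (\<sigma> \<circ> einv) \<circ> einv\<close>, and the vertices can be taken to be the orbits of \<open>\<sigma>\<close>.
\<close>

definition glued_graph ::
    "('w, 'b) lopsp \<Rightarrow> 'b list \<times> 'b list \<Rightarrow> ('v, 'e) emb \<Rightarrow> (('e \<times> 'b) set, 'e \<times> 'b) emb" where
  "glued_graph Op P G =
     (let K = patch Op;
          D = earcs G \<times> earcs K;
          i = perm_restrict (\<lambda>(d, a). (neighbour_chamber Op P G a d, einv K a)) D;
          \<phi> = perm_restrict (\<lambda>(d, a). (d, face_succ K a)) D;
          \<sigma> = \<phi> \<circ> i
      in \<lparr> skel = \<lparr> verts = orbit \<sigma> ` D, arcs = D, tail = orbit \<sigma>, head = \<lambda>x. orbit \<sigma> (i x) \<rparr>,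
           einv = i, rot = \<sigma> \<rparr>)"

text \<open>All elements of a vertex of the glued graph have the same type, that of the vertex in the
  operation of which it is a copy.\<close>

definition glued_type :: "('w, 'b) lopsp \<Rightarrow> ('e \<times> 'b) set \<Rightarrow> nat" where
  "glued_type Op X = the_elem ((\<lambda>(d, a). vtype Op (etail (patch Op) a)) ` X)"

text \<open>
  The embedded graph \<open>H\<close> with barycentric subdivision \<open>B\<close>, typed by \<open>t\<close>. Its vertices are the
  vertices of \<open>B\<close> of type 0. An oriented edge of \<open>H\<close> is represented by its first half, an oriented
  edge of \<open>B\<close> from type 0 to type 1. In \<open>B\<close>, edges to types 1 and 2 alternate around a vertex of
  type 0, and a vertex of type 1 has degree 4 with neighbours alternately of types 0 and 2. So two
  steps of the rotation of \<open>B\<close> lead to the next oriented edge of \<open>H\<close> at a type 0 vertex and to the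
  other half of the same edge at a type 1 vertex.
\<close>

definition unsubdivide :: "('v, 'e) emb \<Rightarrow> ('v \<Rightarrow> nat) \<Rightarrow> ('v, 'e) emb" where
  "unsubdivide B t =
     (let D = {e \<in> earcs B. t (etail B e) = 0 \<and> t (ehead B e) = 1};
          i = perm_restrict (einv B \<circ> rot B \<circ> rot B \<circ> einv B) D;
          \<sigma> = perm_restrict (rot B \<circ> rot B) D
      in \<lparr> skel = \<lparr> verts = {v \<in> everts B. t v = 0}, arcs = D,
                    tail = etail B, head = \<lambda>e. etail B (i e) \<rparr>,
           einv = i, rot = \<sigma> \<rparr>)"

text \<open>The result does not depend on the cut-path, so any one may be chosen.\<close>

definition lopsp_apply ::
    "('w, 'b) lopsp \<Rightarrow> ('v, 'e) emb \<Rightarrow> (('e \<times> 'b) set, 'e \<times> 'b) emb" where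
  "lopsp_apply Op G =
     unsubdivide (glued_graph Op (SOME P. cut_path Op P) G) (glued_type Op)"

text \<open>Every embedded graph is finite and therefore has an isomorphic copy on natural numbers.\<close>

definition c3 :: "('w, 'b) lopsp \<Rightarrow> bool" where
  "c3 Op \<longleftrightarrow>
     (\<forall>G :: (nat, nat) emb.
        polyhedral_embedding G \<longrightarrow> polyhedral_embedding (lopsp_apply Op G))"

end

theory Submission
  imports Defs
begin

text \<open>
  Suppose that \<open>v\<^sub>1\<close> and \<open>v\<^sub>2\<close> are adjacent in the operation and \<open>v\<^sub>2\<close> has type 0. In the graph glued
  from the patches, the centre of every face of \<open>G\<close> is then a vertex of \<open>O(G)\<close>, and it is joined to
  the middle of every edge of the face by an edge of the barycentric subdivision. So for every edge
  \<open>e\<close> of \<open>G\<close> there is a curve from one face centre through the middle of \<open>e\<close> to another one, and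
  this curve meets \<open>O(G)\<close> at no vertex other than the two centres. It may run along an edge of
  \<open>O(G)\<close>, but it crosses none. All these curves together cut the surface into one disc around each
  vertex of \<open>G\<close>. Therefore deleting the face centres, one vertex for each face of \<open>G\<close>, disconnects
  \<open>O(G)\<close> or leaves nothing. If \<open>G\<close> has at most two faces, \<open>O(G)\<close> is not 3-connected
  (\<open>not_3_connected\<close>).

  It remains to find simple 3-connected graphs of every positive genus with two faces. By Euler's
  formula a wheel with \<open>n\<close> spokes and two faces has genus \<open>(n - 1) / 2\<close>. The planar rotation of a
  wheel, with the rotation reversed at the rim vertices only, keeps the outer rim as a face. When \<open>n\<close>
  is odd, it merges everything else into a single facial walk (\<open>card_faces_wheel\<close>).

  To make the discs around the vertices of \<open>G\<close> precise, every oriented edge \<open>(d, a)\<close> of the glued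
  graph is labelled with an end of \<open>d\<close>. The edge from \<open>v\<^sub>1\<close> to \<open>v\<^sub>2\<close> and a cut-path form a cycle in the
  operation. As the operation is plane, this cycle has two sides, and the label is the head or the
  tail of \<open>d\<close> according to the side on which \<open>a\<close> lies (\<open>ex_label\<close>). The labels agree along the sides
  where the double chambers are glued, so only the copies of the edge from \<open>v\<^sub>1\<close> to \<open>v\<^sub>2\<close> separate
  different labels.

  That a cycle in a plane embedded graph has two sides (\<open>cycle_sides\<close>) is obtained by counting: sets
  of faces have boundaries, which are sets of edges with even degrees, and for genus 0 there are as
  many boundaries as such sets. That there is a cut-path (\<open>ex_cut_path\<close>) is an instance of the fact
  that in a 2-connected graph any two vertices are joined by a path through any third one.
\<close>

section \<open>Connected embedded graphs\<close>

text \<open>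
  Connectivity without walks: no proper nonempty set of vertices is closed under adjacency. Both
  proofs and refutations of connectivity below reduce to exhibiting suitable closed sets.
\<close>

lemma connected_iff_closed:
  assumes "wf_digraph H"
  shows "connected H \<longleftrightarrow> verts H \<noteq> {} \<and>
    (\<forall>A \<subseteq> verts H. A \<noteq> {} \<longrightarrow> (\<forall>a \<in> arcs H. tail H a \<in> A \<longleftrightarrow> head H a \<in> A) \<longrightarrow> A = verts H)"
    (is "?L \<longleftrightarrow> ?R")
proof -
  interpret wf_digraph H by fact
  let ?M = "with_proj (mk_symmetric H)"
  interpret M: wf_digraph ?M
    by unfold_locales (auto simp: mk_symmetric_def)
  have ends: "arcs_ends ?M = (\<Union>a\<in>arcs H. {(tail H a, head H a), (head H a, tail H a)})"
    by (auto simp: arcs_ends_conv mk_symmetric_def)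
  have vM: "verts ?M = verts H" by (simp add: mk_symmetric_def)
  have con: "?L \<longleftrightarrow> verts H \<noteq> {} \<and> (\<forall>u\<in>verts H. \<forall>v\<in>verts H. u \<rightarrow>\<^sup>*\<^bsub>?M\<^esub> v)"
    by (simp add: connected_def strongly_connected_def mk_symmetric_def)
  show ?thesis
  proof
    assume L: ?L
    have "A = verts H" if A: "A \<subseteq> verts H" "A \<noteq> {}"
      and cl: "\<forall>a \<in> arcs H. tail H a \<in> A \<longleftrightarrow> head H a \<in> A" for A
    proof -
      obtain u where u: "u \<in> A" using A by auto
      have "v \<in> A" if "v \<in> verts H" for v
      proof -
        have "u \<rightarrow>\<^sup>*\<^bsub>?M\<^esub> v" using L con u A that by blast
        then show ?thesis
          by (induct rule: M.reachable_induct) (use u cl ends in auto)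
      qed
      then show ?thesis using A by auto
    qed
    then show ?R using L con by blast
  next
    assume R: ?R
    have "u \<rightarrow>\<^sup>*\<^bsub>?M\<^esub> v" if u: "u \<in> verts H" and v: "v \<in> verts H" for u v
    proof -
      let ?A = "{w \<in> verts H. u \<rightarrow>\<^sup>*\<^bsub>?M\<^esub> w}"
      have "u \<in> ?A" using u vM by auto
      moreover have "tail H a \<in> ?A \<longleftrightarrow> head H a \<in> ?A" if a: "a \<in> arcs H" for a
        using a ends M.reachable_adj_trans[of u "tail H a" "head H a"]
          M.reachable_adj_trans[of u "head H a" "tail H a"] by auto
      ultimately have "?A = verts H"
        using R[THEN conjunct2, rule_format, of ?A] by blast
      then show ?thesis using v by blast
    qed
    then show ?L using R con by blast
  qed
qed

locale embedded =
  fixes K :: "('v, 'e) emb"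
  assumes embedded: "embedded_graph K"
begin

sublocale fin_digraph "skel K"
  using embedded by (simp add: embedded_graph_def)

sublocale bidirected_digraph "skel K" "einv K"
  using embedded by (simp add: embedded_graph_def)

lemma rot_permutes: "rot K permutes earcs K"
  using embedded by (simp add: embedded_graph_def)

lemma rot_in_arcs [simp]: "rot K a \<in> earcs K \<longleftrightarrow> a \<in> earcs K"
  using rot_permutes by (rule permutes_in_image)

lemma einv_in_arcs [simp]: "einv K a \<in> earcs K \<longleftrightarrow> a \<in> earcs K"
  using arev_permutes_arcs by (rule permutes_in_image)

lemma cyclic_rot: "v \<in> everts K \<Longrightarrow> cyclic_on (rot K) (out_arcs (skel K) v)"
  using embedded by (simp add: embedded_graph_def)

lemma tail_rot [simp]:
  assumes "a \<in> earcs K" shows "etail K (rot K a) = etail K a"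
  using cyclic_on_inI[OF cyclic_rot[of "etail K a"], of a] assms by simp

lemma face_succ_permutes: "face_succ K permutes earcs K"
  unfolding face_succ_def using rot_permutes arev_permutes_arcs by (rule permutes_compose[rotated])

lemma face_succ_in_arcs [simp]: "face_succ K a \<in> earcs K \<longleftrightarrow> a \<in> earcs K"
  using face_succ_permutes by (rule permutes_in_image)

lemma rot_eq_face_succ: "rot K a = face_succ K (einv K a)"
  by (simp add: face_succ_def)

lemma tail_face_succ [simp]: "a \<in> earcs K \<Longrightarrow> etail K (face_succ K a) = ehead K a"
  by (simp add: face_succ_def)

lemma rot_closed_at_vertex:
  assumes "\<And>a. a \<in> A \<Longrightarrow> rot K a \<in> A" "a \<in> A" "a \<in> earcs K" "b \<in> earcs K"
    "etail K b = etail K a"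
  shows "b \<in> A"
proof -
  have "b \<in> orbit (rot K) a"
    using cyclic_rot[of "etail K a"] assms by (auto simp: cyclic_on_alldef)
  then show ?thesis by induct (use assms in auto)
qed

text \<open>Connectivity of the graph makes its arcs a single orbit under rotation and inversion.\<close>

lemma arcs_transitive:
  assumes "A \<subseteq> earcs K" "A \<noteq> {}"
    and rot: "\<And>a. a \<in> A \<Longrightarrow> rot K a \<in> A" and inv: "\<And>a. a \<in> A \<Longrightarrow> einv K a \<in> A"
  shows "A = earcs K"
proof -
  have fwd: "ehead K a \<in> etail K ` A" if a: "a \<in> earcs K" "etail K a \<in> etail K ` A" for a
  proof -
    have "a \<in> A" using rot_closed_at_vertex[OF rot] a assms(1) by auto
    then show ?thesis using inv[of a] a(1) by (metis imageI tail_arev)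
  qed
  have "etail K a \<in> etail K ` A \<longleftrightarrow> ehead K a \<in> etail K ` A" if "a \<in> earcs K" for a
    using fwd[of a] fwd[of "einv K a"] that by auto
  moreover have "etail K ` A \<subseteq> everts K" using assms(1) by auto
  ultimately have "etail K ` A = everts K"
    using embedded assms(2) connected_iff_closed[OF wf_digraph]
    by (simp add: embedded_graph_def)
  then show ?thesis using rot_closed_at_vertex[OF rot] assms(1) by (force simp: image_def)
qed

lemma ex_leaving_arc:
  assumes "U \<subseteq> everts K" "U \<noteq> {}" "U \<noteq> everts K"
  obtains a where "a \<in> earcs K" "etail K a \<in> U" "ehead K a \<notin> U"
proof -
  have "connected (skel K)" using embedded by (simp add: embedded_graph_def)
  then obtain a where "a \<in> earcs K" "etail K a \<in> U \<longleftrightarrow> ehead K a \<notin> U"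
    using assms connected_iff_closed[OF wf_digraph] by blast
  then show ?thesis using that[of a] that[of "einv K a"] by auto
qed

lemma permutation_face_succ: "permutation (face_succ K)"
  unfolding permutation_permutes by (intro exI[of _ "earcs K"] conjI finite_arcs face_succ_permutes)

lemma in_own_face: "a \<in> orbit (face_succ K) a"
  using permutation_face_succ by (rule permutation_self_in_orbit)

lemma in_face_iff:
  assumes "f \<in> faces K"
  shows "a \<in> f \<longleftrightarrow> orbit (face_succ K) a = f"
proof -
  have "cyclic_on (face_succ K) f"
    using assms cyclic_on_orbit[OF face_succ_permutes finite_arcs] by (auto simp: faces_def)
  then show ?thesis using orbit_cyclic_eq3[of "face_succ K" f a] in_own_face[of a] by auto
qed

lemma edge_in_edges: "a \<in> earcs K \<Longrightarrow> {a, einv K a} \<in> edges K"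
  by (auto simp: edges_def)

lemma finite_edges: "finite (edges K)"
  by (simp add: edges_def)

lemma card_arcs: "card (earcs K) = 2 * card (edges K)"
proof -
  have "2 * card (edges K) = card (\<Union>(edges K))"
  proof (rule card_partition)
    show "finite (\<Union>(edges K))" by (auto simp: edges_def)
    show "card e = 2" if "e \<in> edges K" for e
      using that arev_neq[symmetric] by (auto simp: edges_def card_insert_if)
    show "e \<inter> e' = {}" if "e \<in> edges K" "e' \<in> edges K" "e \<noteq> e'" for e e'
      using that by (auto simp: edges_def arev_eq_iff)
  qed (rule finite_edges)
  moreover have "\<Union>(edges K) = earcs K" by (auto simp: edges_def)
  ultimately show ?thesis by simp
qed

end

section \<open>Closed curves on a plane graph separate its faces\<close>

lemma even_card_sym_diff:
  assumes "finite A" "finite B"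
  shows "even (card (sym_diff A B)) \<longleftrightarrow> (even (card A) \<longleftrightarrow> even (card B))"
proof -
  have "card A = card (A - B) + card (A \<inter> B)" "card B = card (B - A) + card (A \<inter> B)"
    using assms by (metis Int_commute card_Diff_subset_Int card_mono finite_Int inf_le1
        le_add_diff_inverse2)+
  moreover have "card (sym_diff A B) = card (A - B) + card (B - A)"
    using assms by (intro card_Un_disjoint) auto
  ultimately show ?thesis by auto
qed

lemma card_fibre: "inj_on f A \<Longrightarrow> card {a \<in> A. f a = v} = (if v \<in> f ` A then 1 else 0)"
proof (cases "v \<in> f ` A")
  case True
  assume "inj_on f A"
  from True obtain a where "a \<in> A" "v = f a" by blast
  then have "{a \<in> A. f a = v} = {a}" using \<open>inj_on f A\<close> by (auto dest: inj_onD)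
  then show ?thesis using True by simp
next
  case False
  then have "{a \<in> A. f a = v} = {}" by auto
  then show ?thesis using False by (simp only: card.empty if_False)
qed

context embedded
begin

text \<open>
  The cycle space over the field with two elements, an edge being represented by both of its arcs. A
  loop contributes two arcs at its vertex, as it should.
\<close>

definition even_arc_sets :: "'e set set" where
  "even_arc_sets = {Z. Z \<subseteq> earcs K \<and> einv K ` Z \<subseteq> Z \<and>
     (\<forall>v \<in> everts K. even (card (Z \<inter> out_arcs (skel K) v)))}"

definition face_boundary :: "'e set \<Rightarrow> 'e set" where
  "face_boundary A = {a \<in> earcs K. (a \<in> A) \<noteq> (einv K a \<in> A)}"

lemma sym_diff_even_arc_sets:
  assumes Y: "Y \<in> even_arc_sets" and Z: "Z \<in> even_arc_sets"
  shows "sym_diff Y Z \<in> even_arc_sets"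
  unfolding even_arc_sets_def
proof (intro CollectI conjI ballI)
  have inv: "einv K a \<in> X \<longleftrightarrow> a \<in> X" if "X \<in> even_arc_sets" for a X
  proof -
    have "einv K b \<in> X" if "b \<in> X" for b
      using that \<open>X \<in> even_arc_sets\<close> unfolding even_arc_sets_def by blast
    from this[of a] this[of "einv K a"] show ?thesis by auto
  qed
  show "sym_diff Y Z \<subseteq> earcs K" using Y Z by (auto simp: even_arc_sets_def)
  show "einv K ` sym_diff Y Z \<subseteq> sym_diff Y Z" using inv[OF Y] inv[OF Z] by auto
  fix v assume v: "v \<in> everts K"
  let ?O = "out_arcs (skel K) v"
  have "even (card (Y \<inter> ?O))" "even (card (Z \<inter> ?O))"
    using Y Z v by (auto simp: even_arc_sets_def)
  moreover have "sym_diff Y Z \<inter> ?O = sym_diff (Y \<inter> ?O) (Z \<inter> ?O)" by auto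
  ultimately show "even (card (sym_diff Y Z \<inter> ?O))"
    by (simp add: even_card_sym_diff finite_out_arcs)
qed

text \<open>
  Going around a vertex, one enters a set of faces as often as one leaves it.
\<close>

lemma face_boundary_even:
  assumes A: "A \<subseteq> earcs K" "\<And>a. a \<in> earcs K \<Longrightarrow> face_succ K a \<in> A \<longleftrightarrow> a \<in> A"
  shows "face_boundary A \<in> even_arc_sets"
proof -
  have "even (card (face_boundary A \<inter> out_arcs (skel K) v))" if v: "v \<in> everts K" for v
  proof -
    let ?O = "out_arcs (skel K) v"
    have "rot K ` ?O = ?O"
      by (intro card_subset_eq) (auto intro!: card_image inj_on_subset[OF permutes_inj[OF rot_permutes]])
    have fin: "finite ?O" by (rule finite_out_arcs)
    have "rot K ` (rot K -` A \<inter> ?O) = A \<inter> rot K ` ?O" by blast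
    then have "rot K ` (rot K -` A \<inter> ?O) = A \<inter> ?O"
      by (simp only: \<open>rot K ` ?O = ?O\<close>)
    then have c: "card (rot K -` A \<inter> ?O) = card (A \<inter> ?O)"
      using card_image[of "rot K" "rot K -` A \<inter> ?O"] permutes_inj[OF rot_permutes]
      by (metis inj_on_subset subset_UNIV)
    have "einv K a \<in> A \<longleftrightarrow> rot K a \<in> A" if "a \<in> earcs K" for a
      using A(2)[of "einv K a"] that by (simp add: rot_eq_face_succ)
    then have "face_boundary A \<inter> ?O = sym_diff (A \<inter> ?O) (rot K -` A \<inter> ?O)"
      by (auto simp: face_boundary_def)
    then show ?thesis using c fin by (simp add: even_card_sym_diff)
  qed
  then show ?thesis by (auto simp: even_arc_sets_def face_boundary_def)
qed

text \<open>
  Where two sets of faces with equal boundaries agree, they also agree across every edge. As the dual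
  graph is connected, they agree everywhere or nowhere.
\<close>

lemma face_boundary_eq_imp:
  assumes A: "A \<subseteq> earcs K" "\<And>a. a \<in> earcs K \<Longrightarrow> face_succ K a \<in> A \<longleftrightarrow> a \<in> A"
    and B: "B \<subseteq> earcs K" "\<And>a. a \<in> earcs K \<Longrightarrow> face_succ K a \<in> B \<longleftrightarrow> a \<in> B"
    and eq: "face_boundary A = face_boundary B"
  shows "B \<in> {A, earcs K - A}"
proof -
  let ?C = "{a \<in> earcs K. a \<in> A \<longleftrightarrow> a \<in> B}"
  have inv: "einv K a \<in> ?C" if "a \<in> ?C" for a
    using eq that unfolding face_boundary_def by auto
  have rot: "rot K a \<in> ?C" if "a \<in> ?C" for a
    using inv[OF that] A(2)[of "einv K a"] B(2)[of "einv K a"] by (simp add: rot_eq_face_succ)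
  have "?C = {} \<or> ?C = earcs K"
    using arcs_transitive[of ?C] inv rot by blast
  then show ?thesis using A(1) B(1) by blast
qed

text \<open>
  A tree \<open>T\<close> on \<open>k\<close> vertices is grown by adding an edge that leaves its vertex set \<open>U\<close>. Acyclicity is
  expressed by the last conjunct, which survives the step because the new vertex is a leaf: an even
  set cannot contain the only edge of \<open>T\<close> at a vertex.
\<close>

lemma ex_spanning_tree:
  assumes "1 \<le> k" "k \<le> card (everts K)"
  shows "\<exists>U T. U \<subseteq> everts K \<and> card U = k \<and> T \<subseteq> edges K \<and> card T = k - 1 \<and>
    (\<forall>a \<in> \<Union>T. etail K a \<in> U) \<and> (\<forall>Z \<in> even_arc_sets. Z \<subseteq> \<Union>T \<longrightarrow> Z = {})"
  using assms
proof (induct k rule: dec_induct)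
  case base
  then have "everts K \<noteq> {}" by auto
  then obtain v where "v \<in> everts K" by auto
  then show ?case by (intro exI[of _ "{v}"] exI[of _ "{}"]) auto
next
  case (step k)
  then obtain U T where UT: "U \<subseteq> everts K" "card U = k" "T \<subseteq> edges K" "card T = k - 1"
    and tail: "\<forall>a \<in> \<Union>T. etail K a \<in> U"
    and acyc: "\<forall>Z \<in> even_arc_sets. Z \<subseteq> \<Union>T \<longrightarrow> Z = {}" by auto
  have "U \<noteq> {}" "U \<noteq> everts K" using UT step by auto
  then obtain a where a: "a \<in> earcs K" "etail K a \<in> U" "ehead K a \<notin> U"
    using ex_leaving_arc UT(1) by blast
  let ?U = "insert (ehead K a) U" and ?T = "insert {a, einv K a} T"
  have new: "{a, einv K a} \<notin> T" using tail a by auto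
  have finU: "finite U" using UT(1) finite_verts by (rule finite_subset)
  have finT: "finite T" using UT(3) finite_edges by (rule finite_subset)
  have "card ?U = Suc k" using a finU UT by simp
  moreover have "card ?T = Suc k - 1" using new finT UT step by simp
  moreover have "Z = {}" if Z: "Z \<in> even_arc_sets" "Z \<subseteq> \<Union>?T" for Z
  proof -
    have "b = einv K a" if "b \<in> Z" "etail K b = ehead K a" for b
    proof -
      have "b = a \<or> b = einv K a \<or> b \<in> \<Union>T" using Z(2) that(1) by blast
      moreover have "b \<notin> \<Union>T" using bspec[OF tail, of b] a(3) that(2) by metis
      moreover have "b \<noteq> a" using a(2,3) that(2) by metis
      ultimately show ?thesis by blast
    qed
    then have "Z \<inter> out_arcs (skel K) (ehead K a) \<subseteq> {einv K a}" by auto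
    moreover have "even (card (Z \<inter> out_arcs (skel K) (ehead K a)))"
      using Z(1) a(1) by (auto simp: even_arc_sets_def)
    ultimately have "Z \<inter> out_arcs (skel K) (ehead K a) = {}"
      by (auto simp: subset_singleton_iff)
    then have "einv K a \<notin> Z" using a(1) by auto
    moreover then have "a \<notin> Z" using Z(1) by (auto simp: even_arc_sets_def)
    ultimately have "Z \<subseteq> \<Union>T" using Z(2) by auto
    then show ?thesis using acyc Z(1) by auto
  qed
  moreover have "\<forall>b \<in> \<Union>?T. etail K b \<in> ?U" using tail a by auto
  ultimately show ?case using UT a edge_in_edges
    by (intro exI[of _ ?U] exI[of _ ?T]) auto
qed

text \<open>
  A cycle is determined by its edges outside a spanning tree, since the difference of two cycles
  that agree there lies in the tree.
\<close>

lemma card_even_arc_sets_le: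
  "card even_arc_sets \<le> 2 ^ (card (edges K) - (card (everts K) - 1))"
proof -
  have "everts K \<noteq> {}" using embedded
    by (simp add: embedded_graph_def connected_iff_closed[OF wf_digraph])
  then have "1 \<le> card (everts K)" by (simp add: Suc_leI card_gt_0_iff)
  then obtain T where T: "T \<subseteq> edges K" "card T = card (everts K) - 1"
    and acyc: "\<forall>Z \<in> even_arc_sets. Z \<subseteq> \<Union>T \<longrightarrow> Z = {}"
    using ex_spanning_tree[of "card (everts K)"] by auto
  let ?f = "\<lambda>Z. {e \<in> edges K - T. e \<subseteq> Z}"
  have "inj_on ?f even_arc_sets"
  proof (rule inj_onI)
    fix Y Z assume Y: "Y \<in> even_arc_sets" and Z: "Z \<in> even_arc_sets" and eq: "?f Y = ?f Z"
    have "sym_diff Y Z \<subseteq> \<Union>T"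
    proof
      fix a assume a: "a \<in> sym_diff Y Z"
      have "a \<in> earcs K" using a Y Z by (auto simp: even_arc_sets_def)
      then have "{a, einv K a} \<in> edges K" by (rule edge_in_edges)
      moreover have "{a, einv K a} \<subseteq> Y \<longleftrightarrow> a \<in> Y" "{a, einv K a} \<subseteq> Z \<longleftrightarrow> a \<in> Z"
        using Y Z by (auto simp: even_arc_sets_def)
      moreover have "{a, einv K a} \<in> ?f Y \<longleftrightarrow> {a, einv K a} \<in> ?f Z" using eq by simp
      ultimately have "{a, einv K a} \<in> T" using a by auto
      then show "a \<in> \<Union>T" by blast
    qed
    then have "sym_diff Y Z = {}" using acyc sym_diff_even_arc_sets[OF Y Z] by blast
    then show "Y = Z" by blast
  qed
  then have "card even_arc_sets \<le> card (Pow (edges K - T))"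
    by (rule card_inj_on_le) (use finite_edges in auto)
  also have "\<dots> = 2 ^ (card (edges K) - (card (everts K) - 1))"
    using T finite_edges finite_subset[OF T(1)] by (simp add: card_Pow card_Diff_subset)
  finally show ?thesis .
qed

lemma card_tree_le: "card (everts K) \<le> Suc (card (edges K))"
proof -
  have "card (everts K) = 0 \<or> 1 \<le> card (everts K)" by linarith
  then show ?thesis
  proof
    assume "1 \<le> card (everts K)"
    then obtain T where T: "T \<subseteq> edges K" "card T = card (everts K) - 1"
      using ex_spanning_tree[of "card (everts K)"] by auto
    then show ?thesis using card_mono[OF finite_edges T(1)] by linarith
  qed linarith
qed

text \<open>
  There are \<open>2 ^ card (faces K)\<close> sets of faces, at most two with the same boundary, hence at least
  \<open>2 ^ (card (faces K) - 1)\<close> boundaries. By Euler's formula this is the bound for the number of even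
  sets in \<open>card_even_arc_sets_le\<close>, so that every even set is a boundary.
\<close>

lemma plane_cycle_bounds:
  assumes "genus K = 0" "Z \<in> even_arc_sets"
  obtains A where "A \<subseteq> earcs K" "\<And>a. a \<in> earcs K \<Longrightarrow> face_succ K a \<in> A \<longleftrightarrow> a \<in> A"
    "\<And>a. a \<in> earcs K \<Longrightarrow> a \<in> Z \<longleftrightarrow> (a \<in> A) \<noteq> (einv K a \<in> A)"
proof -
  let ?X = "{A. A \<subseteq> earcs K \<and> (\<forall>a \<in> earcs K. face_succ K a \<in> A \<longleftrightarrow> a \<in> A)}"
  have finX: "finite ?X" by (rule finite_subset[of _ "Pow (earcs K)"]) auto
  have finE: "finite even_arc_sets"
    by (rule finite_subset[of _ "Pow (earcs K)"]) (auto simp: even_arc_sets_def)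
  define u where "u F = {a \<in> earcs K. orbit (face_succ K) a \<in> F}" for F
  have "inj_on u (Pow (faces K))"
    by (rule inj_onI) (auto simp: u_def faces_def set_eq_iff)
  moreover have "u F \<in> ?X" for F
  proof -
    have "orbit (face_succ K) (face_succ K a) = orbit (face_succ K) a" if "a \<in> earcs K" for a
      using that in_own_face in_face_iff[of "orbit (face_succ K) a" "face_succ K a"]
      by (auto simp: faces_def intro: orbit.base)
    then show ?thesis by (auto simp: u_def)
  qed
  ultimately have "card (Pow (faces K)) \<le> card ?X"
    using finX by (intro card_inj_on_le) auto
  then have "2 ^ card (faces K) \<le> card ?X"
    by (simp add: card_Pow faces_def)
  also have "card ?X = (\<Sum>y\<in>face_boundary ` ?X. card {A \<in> ?X. face_boundary A = y})"
    using sum.image_gen[OF finX, of "\<lambda>_. 1::nat" face_boundary] by simp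
  also have "\<dots> \<le> (\<Sum>y\<in>face_boundary ` ?X. 2)"
  proof (rule sum_mono)
    fix y assume "y \<in> face_boundary ` ?X"
    then obtain A where A: "A \<in> ?X" "y = face_boundary A" by (rule imageE)
    have "B \<in> {A, earcs K - A}" if "B \<in> ?X" "face_boundary B = y" for B
      using A that by (intro face_boundary_eq_imp) simp_all
    then have "{B \<in> ?X. face_boundary B = y} \<subseteq> {A, earcs K - A}" by blast
    then have "card {B \<in> ?X. face_boundary B = y} \<le> card {A, earcs K - A}"
      by (intro card_mono) auto
    also have "\<dots> \<le> 2" by (simp add: card_insert_if)
    finally show "card {B \<in> ?X. face_boundary B = y} \<le> 2" .
  qed
  finally have lower: "2 ^ card (faces K) \<le> 2 * card (face_boundary ` ?X)" by simp
  have euler: "card (faces K) = Suc (card (edges K) - (card (everts K) - 1))"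
  proof -
    have "real (card (faces K) + card (everts K)) = real (card (edges K) + 2)"
      using assms(1) by (simp add: genus_def)
    then have e: "card (faces K) + card (everts K) = card (edges K) + 2"
      using of_nat_eq_iff by blast
    have "earcs K \<noteq> {}" using embedded by (simp add: embedded_graph_def)
    then have "everts K \<noteq> {}" using tail_in_verts by blast
    then have "1 \<le> card (everts K)" by (simp add: Suc_leI card_gt_0_iff)
    then show ?thesis using e card_tree_le by linarith
  qed
  have sub: "face_boundary ` ?X \<subseteq> even_arc_sets"
  proof (rule image_subsetI)
    fix A assume "A \<in> ?X"
    then show "face_boundary A \<in> even_arc_sets" by (intro face_boundary_even) simp_all
  qed
  have "card even_arc_sets \<le> card (face_boundary ` ?X)"
    using lower card_even_arc_sets_le by (simp add: euler)
  then have "face_boundary ` ?X = even_arc_sets" by (rule card_seteq[OF finE sub])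
  then have "Z \<in> face_boundary ` ?X" using assms(2) by simp
  then obtain A where "Z = face_boundary A" "A \<in> ?X" by (rule imageE)
  then show ?thesis using that[of A] by (simp add: face_boundary_def)
qed

lemma apath_inverse_notin:
  assumes "apath u p v" "a \<in> set p"
  shows "einv K a \<notin> set p"
  using assms
proof (induct p arbitrary: u a)
  case (Cons e p)
  have p: "awalk (ehead K e) p v" "distinct (awalk_verts (ehead K e) p)" "e \<in> earcs K"
    "etail K e \<notin> set (awalk_verts (ehead K e) p)"
    using Cons.prems(1) by (auto simp: apath_def awalk_Cons_iff)
  have heads: "ehead K b \<noteq> etail K e" "b \<in> earcs K" if "b \<in> set p" for b
  proof -
    have "ehead K b \<in> set (awalk_verts (ehead K e) p)"
      using that set_awalk_verts[OF p(1)] by auto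
    then show "ehead K b \<noteq> etail K e" using p(4) by metis
    show "b \<in> earcs K" using p(1) that by (auto simp: awalk_def)
  qed
  have ind: "einv K b \<notin> set p" if "b \<in> set p" for b
    using Cons.hyps[of "ehead K e" ] p(1,2) that by (auto simp: apath_def)
  have "ehead K (einv K e) = etail K e" using p(3) by simp
  then have e: "einv K e \<notin> set p" using heads by blast
  show ?case
  proof (cases "a = e")
    case True
    then show ?thesis using e arev_neq[OF p(3)] by simp
  next
    case False
    then have "a \<in> set p" using Cons.prems(2) by simp
    moreover then have "einv K a \<noteq> e" using e by auto
    ultimately show ?thesis using ind by simp
  qed
qed simp

lemma apath_ends:
  assumes "apath u p v" "p \<noteq> []"
  shows "inj_on (etail K) (set p)" "inj_on (ehead K) (set p)" "v \<notin> etail K ` set p"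
    "u \<notin> ehead K ` set p" "insert v (etail K ` set p) = insert u (ehead K ` set p)"
    "set p \<subseteq> earcs K"
proof -
  have w: "cas u p v" "distinct (awalk_verts u p)" "set p \<subseteq> earcs K" "last (awalk_verts u p) = v"
    "hd (awalk_verts u p) = u"
    using assms(1) by (auto simp: apath_def)
  have 1: "awalk_verts u p = map (etail K) p @ [v]"
    using w(4) assms(2) by (simp add: awalk_verts_conv)
  have 2: "awalk_verts u p = u # map (ehead K) p"
    using w(5) awalk_verts_conv'[OF w(1)] assms(2) by simp
  show "inj_on (etail K) (set p)" "v \<notin> etail K ` set p"
    using w(2) unfolding 1 by (simp_all add: distinct_map)
  show "inj_on (ehead K) (set p)" "u \<notin> ehead K ` set p"
    using w(2) unfolding 2 by (simp_all add: distinct_map)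
  have "set (map (etail K) p @ [v]) = set (u # map (ehead K) p)" using 1 2 by simp
  then show "insert v (etail K ` set p) = insert u (ehead K ` set p)" by simp
  show "set p \<subseteq> earcs K" by (rule w(3))
qed

text \<open>
  Every vertex that \<open>Q\<close> meets is left by one arc of \<open>Q\<close> and entered by one, which contributes its
  inverse. The last assumption ensures that these two arcs are different.
\<close>

lemma cycle_even:
  assumes Q: "Q \<subseteq> earcs K" "inj_on (etail K) Q" "inj_on (ehead K) Q" "etail K ` Q = ehead K ` Q"
    and simple: "\<And>a. a \<in> Q \<Longrightarrow> einv K a \<notin> Q"
  shows "Q \<union> einv K ` Q \<in> even_arc_sets"
  unfolding even_arc_sets_def
proof (intro CollectI conjI ballI)
  show "Q \<union> einv K ` Q \<subseteq> earcs K" "einv K ` (Q \<union> einv K ` Q) \<subseteq> Q \<union> einv K ` Q"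
    using Q(1) by auto
  fix v
  have finQ: "finite Q" using Q(1) finite_arcs by (rule finite_subset)
  have "ehead K a = v \<longleftrightarrow> etail K (einv K a) = v" if "a \<in> Q" for a using Q(1) that by auto
  then have "(Q \<union> einv K ` Q) \<inter> out_arcs (skel K) v =
      {a \<in> Q. etail K a = v} \<union> einv K ` {a \<in> Q. ehead K a = v}"
    using Q(1) by auto
  moreover have "card ({a \<in> Q. etail K a = v} \<union> einv K ` {a \<in> Q. ehead K a = v}) =
      card {a \<in> Q. etail K a = v} + card {a \<in> Q. ehead K a = v}"
  proof (subst card_Un_disjoint)
    show "{a \<in> Q. etail K a = v} \<inter> einv K ` {a \<in> Q. ehead K a = v} = {}"
      using simple by auto
    show "card {a \<in> Q. etail K a = v} + card (einv K ` {a \<in> Q. ehead K a = v}) =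
        card {a \<in> Q. etail K a = v} + card {a \<in> Q. ehead K a = v}"
      by (simp add: card_image inj_on_arev)
  qed (use finQ in auto)
  ultimately show "even (card ((Q \<union> einv K ` Q) \<inter> out_arcs (skel K) v))"
    using card_fibre[OF Q(2), of v] card_fibre[OF Q(3), of v] Q(4) by simp
qed

text \<open>
  At the vertex between the consecutive arcs \<open>a\<close> and \<open>b\<close> of a cycle, one changes sides only at \<open>b\<close>
  and at the inverse of \<open>a\<close>. If these two had the same side, then after turning past one of them one
  would stay on the opposite side all the way round and never come back to \<open>b\<close>.
\<close>

lemma cycle_same_side:
  assumes Q: "Q \<subseteq> earcs K" "inj_on (etail K) Q" "inj_on (ehead K) Q"
    and A: "\<And>a. a \<in> earcs K \<Longrightarrow> face_succ K a \<in> A \<longleftrightarrow> a \<in> A"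
    and Z: "\<And>a. a \<in> earcs K \<Longrightarrow> a \<in> Q \<union> einv K ` Q \<longleftrightarrow> (a \<in> A) \<noteq> (einv K a \<in> A)"
    and ab: "a \<in> Q" "b \<in> Q" "ehead K a = etail K b"
  shows "a \<in> A \<longleftrightarrow> b \<in> A"
proof (rule ccontr)
  assume neq: "\<not> ?thesis"
  have arcs: "a \<in> earcs K" "b \<in> earcs K" using subsetD[OF Q(1)] ab(1,2) by blast+
  let ?a = "einv K a"
  have same: "?a \<in> A \<longleftrightarrow> b \<in> A" using neq Z[OF arcs(1)] ab(1) by blast
  have rot: "rot K x \<in> A \<longleftrightarrow> (x \<in> A) \<noteq> (x \<in> Q \<union> einv K ` Q)" if "x \<in> earcs K" for x
  proof -
    have "rot K x \<in> A \<longleftrightarrow> einv K x \<in> A"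
      using A[of "einv K x"] that by (simp add: rot_eq_face_succ)
    then show ?thesis using Z[OF that] by argo
  qed
  let ?M = "{x \<in> earcs K. etail K x = etail K b \<and> (x \<in> A \<longleftrightarrow> b \<notin> A)}"
  have start: "rot K b \<in> ?M" using rot[OF arcs(2)] arcs(2) ab(2) by simp
  have "rot K x \<in> ?M" if x: "x \<in> ?M" for x
  proof -
    have "x \<notin> Q"
    proof
      assume "x \<in> Q"
      then have "x = b" using inj_onD[OF Q(2)] ab(2) x by simp
      then show False using x by simp
    qed
    moreover have "x \<notin> einv K ` Q"
    proof
      assume "x \<in> einv K ` Q"
      then obtain y where y: "y \<in> Q" "x = einv K y" by auto
      then have "ehead K y = ehead K a" using x ab(3) Q(1) by auto
      then have "y = a" using inj_onD[OF Q(3)] ab(1) y(1) by simp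
      then show False using x y(2) same by simp
    qed
    ultimately show ?thesis using rot[of x] x by simp
  qed
  then have "b \<in> ?M"
    by (rule rot_closed_at_vertex[OF _ start]) (use arcs(2) in simp_all)
  then show False by simp
qed

lemma walk_constant:
  assumes "cas u p v"
    and "\<And>a b. a \<in> set p \<Longrightarrow> b \<in> set p \<Longrightarrow> ehead K a = etail K b \<Longrightarrow> f a = f b"
  shows "a \<in> set p \<Longrightarrow> f a = f (hd p)"
  using assms
proof (induct p arbitrary: u)
  case (Cons e p)
  show ?case
  proof (cases "p = []")
    case False
    have "f (hd p) = f e"
      using Cons.prems(2) False Cons.prems(3)[of e "hd p"] by (cases p) auto
    moreover have "f a = f (hd p)" if "a \<in> set p"
      using that Cons.prems by (intro Cons.hyps[of "ehead K e"]) auto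
    ultimately show ?thesis using Cons.prems(1) by auto
  qed (use Cons.prems in auto)
qed simp

text \<open>
  The path \<open>p\<close> and the arc \<open>c\<close> form a closed curve. An arc is in \<open>L\<close> if the face on its left is on
  the same side of this curve as the faces on the left of \<open>p\<close>.
\<close>

lemma cycle_sides:
  assumes plane: "genus K = 0" and p: "apath u p v" "p \<noteq> []"
    and c: "c \<in> earcs K" "etail K c = u" "ehead K c = v" "c \<notin> set p"
  obtains L where
    "\<And>a. a \<in> earcs K \<Longrightarrow> face_succ K a \<in> L \<longleftrightarrow> a \<in> L"
    "\<And>a. a \<in> set p \<Longrightarrow> a \<in> L \<and> einv K a \<notin> L"
    "\<And>a. a \<in> earcs K \<Longrightarrow> a \<notin> set p \<Longrightarrow> einv K a \<notin> set p \<Longrightarrow> a \<noteq> c \<Longrightarrow> einv K a \<noteq> c \<Longrightarrow>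
      einv K a \<in> L \<longleftrightarrow> a \<in> L"
proof -
  note e = apath_ends[OF p]
  \<comment> \<open>The path runs from the tail of \<open>c\<close> to its head, so the inverse of \<open>c\<close> closes it up.\<close>
  let ?Q = "insert (einv K c) (set p)"
  have "etail K (hd p) = u" using p cas_simp[of p u v] by (auto simp: apath_def)
  then have uv: "u \<noteq> v" using e(3) p(2) by (metis hd_in_set imageI)
  have c': "etail K (einv K c) = v" "ehead K (einv K c) = u" "einv K c \<notin> set p"
    using c e(3) imageI[of "einv K c" "set p" "etail K"] by auto
  have Q: "?Q \<subseteq> earcs K" "inj_on (etail K) ?Q" "inj_on (ehead K) ?Q" "etail K ` ?Q = ehead K ` ?Q"
    using e c c' by auto
  have simple: "einv K a \<notin> ?Q" if "a \<in> ?Q" for a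
    using that apath_inverse_notin[OF p(1), of a] c(1,4) c'(3) arev_neq[of c] arev_neq[of "einv K c"]
    by (auto simp: arev_eq_iff)
  obtain A where A: "\<And>a. a \<in> earcs K \<Longrightarrow> face_succ K a \<in> A \<longleftrightarrow> a \<in> A"
    "\<And>a. a \<in> earcs K \<Longrightarrow> a \<in> ?Q \<union> einv K ` ?Q \<longleftrightarrow> (a \<in> A) \<noteq> (einv K a \<in> A)"
    using plane_cycle_bounds[OF plane cycle_even[OF Q simple]] by metis
  have same: "a \<in> A \<longleftrightarrow> hd p \<in> A" if "a \<in> set p" for a
  proof (rule walk_constant[where f = "\<lambda>a. a \<in> A"])
    show "cas u p v" using p(1) by (auto simp: apath_def)
    show "a \<in> A \<longleftrightarrow> b \<in> A" if "a \<in> set p" "b \<in> set p" "ehead K a = etail K b" for a b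
      using that by (intro cycle_same_side[OF Q(1-3) A]) auto
  qed (rule that)
  define L where "L = (if hd p \<in> A then A else - A)"
  show thesis
  proof (rule that[of L])
    show "face_succ K a \<in> L \<longleftrightarrow> a \<in> L" if "a \<in> earcs K" for a
      using A(1)[OF that] by (auto simp: L_def)
    show "a \<in> L \<and> einv K a \<notin> L" if "a \<in> set p" for a
      using same[OF that] A(2)[of a] that e(6) by (auto simp: L_def)
    show "einv K a \<in> L \<longleftrightarrow> a \<in> L" if "a \<in> earcs K" "a \<notin> set p" "einv K a \<notin> set p"
      "a \<noteq> c" "einv K a \<noteq> c" for a
    proof -
      have "a \<notin> ?Q \<union> einv K ` ?Q" using that by auto
      then show ?thesis using A(2)[OF that(1)] by (auto simp: L_def)
    qed
  qed
qed

end

section \<open>Cut-paths\<close>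

definition simple_path :: "('v \<Rightarrow> 'v \<Rightarrow> bool) \<Rightarrow> 'v set \<Rightarrow> 'v \<Rightarrow> 'v list \<Rightarrow> 'v \<Rightarrow> bool" where
  "simple_path E W x xs y \<longleftrightarrow> xs \<noteq> [] \<and> hd xs = x \<and> last xs = y \<and> distinct xs \<and>
     successively E xs \<and> set xs \<subseteq> W"

lemma successively_join:
  assumes "successively E (xs @ [z])" "successively E (z # ys)"
  shows "successively E (xs @ z # ys)"
  using assms by (cases xs rule: rev_cases) (auto simp: successively_append_iff)

lemma successively_suffix: "successively E (xs @ ys) \<Longrightarrow> successively E ys"
  by (simp add: successively_append_iff)

lemma simple_path_extend:
  assumes "simple_path E W x xs y" "E y z" "z \<in> W" "z \<notin> set xs"
  shows "simple_path E W x (xs @ [z]) z"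
  using assms by (auto simp: simple_path_def successively_append_iff)

lemma simple_path_prefix:
  assumes "simple_path E W x (xs @ z # ys) y"
  shows "simple_path E W x (xs @ [z]) z"
proof -
  have "successively E ((xs @ [z]) @ ys)" using assms by (simp add: simple_path_def)
  then have "successively E (xs @ [z])" using successively_append_iff by blast
  then show ?thesis using assms by (cases xs) (auto simp: simple_path_def)
qed

lemma simple_path_step:
  assumes "simple_path E W x xs y" "E y z" "z \<in> W"
  shows "\<exists>ys. simple_path E W x ys z"
  using assms simple_path_extend simple_path_prefix by (metis split_list)

text \<open>
  Follow the path \<open>xs\<close> from \<open>a\<close> through \<open>b\<close> to \<open>w\<close> and go on to \<open>w'\<close>. The only difficulty is a vertex
  \<open>w'\<close> that occurs on \<open>xs\<close> before \<open>b\<close>: then the part of \<open>xs\<close> after \<open>w'\<close> closes up to a cycle through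
  \<open>b\<close> and \<open>w'\<close>. The path \<open>rs\<close> from \<open>a\<close> to \<open>b\<close> avoids \<open>w'\<close>, so it first meets this cycle in a vertex
  \<open>z\<close> other than \<open>w'\<close>; from \<open>z\<close>, one of the two ways round the cycle to \<open>w'\<close> passes through \<open>b\<close>.
\<close>

lemma reroute_through:
  assumes sym: "symp E"
    and P: "simple_path E W a xs w" "b \<in> set xs"
    and w': "E w w'" "w' \<in> W" "w' \<noteq> a" "w' \<noteq> b"
    and R: "simple_path E (W - {w'}) a rs b"
  shows "\<exists>ys. simple_path E W a ys w' \<and> b \<in> set ys"
proof (cases "w' \<in> set xs")
  case False
  then show ?thesis using simple_path_extend[OF P(1) w'(1,2)] P(2) by auto
next
  case True
  then obtain p q where xs: "xs = p @ w' # q" by (auto dest: split_list)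
  show ?thesis
  proof (cases "b \<in> set p")
    case True
    then show ?thesis
      using simple_path_prefix[of E W a p w' q w] P(1) xs by (intro exI[of _ "p @ [w']"]) auto
  next
    case False
    then obtain ys zs where q: "q = ys @ b # zs"
      using P(2) xs w'(4) by (auto dest: split_list)
    let ?Y = "set q"
    have "b \<in> set rs" using R by (auto simp: simple_path_def)
    then have "\<exists>z \<in> set rs. z \<in> ?Y" using q by auto
    then obtain r z r' where rs: "rs = r @ z # r'" "z \<in> ?Y" "\<forall>y \<in> set r. y \<notin> ?Y"
      using split_list_first_prop[of rs "\<lambda>z. z \<in> ?Y"] by blast
    have Rz: "simple_path E (W - {w'}) a (r @ [z]) z"
      using R simple_path_prefix[of E _ a r z r' b] by (simp add: rs(1))
    have q_path: "successively E (w' # q)" "distinct (w' # q)" "last q = w" "set q \<subseteq> W"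
      using P(1) xs q by (auto simp: simple_path_def successively_append_iff)
    have q_ext: "successively E (w' # q @ [w'])"
      using q_path(1,3) q w'(1) by (subst append_Cons[symmetric], subst successively_append_iff) auto
    have E_sym: "E y x" if "E x y" for x y using sym that by (rule sympD)
    have rev: "successively E (rev l)" if "successively E l" for l
      using that E_sym by (simp add: successively_rev successively_mono)
    have Rz': "r @ [z] \<noteq> []" "hd (r @ [z]) = a" "distinct (r @ [z])"
      "successively E (r @ [z])" "set (r @ [z]) \<subseteq> W - {w'}"
      using Rz by (auto simp: simple_path_def)
    \<comment> \<open>A continuation of \<open>r\<close> from \<open>z\<close> round the cycle, through \<open>b\<close> to \<open>w'\<close>.\<close>
    have return: ?thesis
      if t: "successively E (z # t @ [w'])" "b \<in> set (z # t)" "distinct (z # t)" "set t \<subseteq> set q" for t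
    proof -
      let ?l = "(r @ [z]) @ t @ [w']"
      have "successively E ?l"
        using successively_join[OF Rz'(4), of "t @ [w']"] t(1) by simp
      moreover have "set (r @ [z]) \<inter> set (t @ [w']) = {}"
        using t(3,4) rs(3) Rz'(5) by auto
      moreover have "distinct (t @ [w'])" using t(3,4) q_path(2) by auto
      moreover have "set ?l \<subseteq> W" using Rz'(5) t(4) q_path(4) w'(2) by auto
      ultimately have "simple_path E W a ?l w'"
        using Rz'(1-3) by (auto simp: simple_path_def hd_append split: if_splits)
      moreover have "b \<in> set ?l" using t(2) by auto
      ultimately show ?thesis by blast
    qed
    consider y1 y2 where "ys = y1 @ z # y2" | "z = b" | z1 z2 where "zs = z1 @ z # z2"
      using rs(2) q by (auto dest: split_list)
    then show ?thesis
    proof cases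
      case 1
      have "successively E (z # y2 @ b # zs @ [w'])"
        using q_ext q 1 successively_suffix[of E "w' # y1"] by simp
      then show ?thesis using q_path(2) q 1 by (intro return[of "y2 @ b # zs"]) auto
    next
      case 2
      have "successively E (b # zs @ [w'])"
        using q_ext q successively_suffix[of E "w' # ys"] by simp
      then show ?thesis using q_path(2) q 2 by (intro return[of zs]) auto
    next
      case 3
      have "successively E (w' # ys @ b # z1 @ [z])"
        using q_path(1) q 3 successively_append_iff[of E "w' # ys @ b # z1 @ [z]" z2] by simp
      from rev[OF this] have "successively E (z # rev z1 @ b # rev ys @ [w'])" by simp
      then show ?thesis using q_path(2) q 3 by (intro return[of "rev z1 @ b # rev ys"]) auto
    qed
  qed
qed

context embedded
begin

abbreviation adj :: "'v \<Rightarrow> 'v \<Rightarrow> bool" where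
  "adj x y \<equiv> x \<rightarrow>\<^bsub>skel K\<^esub> y"

lemma symp_adj: "symp adj"
  unfolding symp_def arcs_ends_conv by (force intro: image_eqI[where x="einv K _"])

lemma ex_simple_path:
  assumes W: "W \<subseteq> everts K" and con: "connected (skel K \<restriction> W)" and xy: "x \<in> W" "y \<in> W"
  shows "\<exists>xs. simple_path adj W x xs y"
proof -
  let ?A = "{y \<in> W. \<exists>xs. simple_path adj W x xs y}"
  have wf: "wf_digraph (skel K \<restriction> W)" by (rule wellformed_induce_subgraph)
  have "simple_path adj W x [x] x" using xy by (simp add: simple_path_def)
  then have "x \<in> ?A" using xy by blast
  have step: "ehead K a \<in> ?A" if "a \<in> earcs K" "etail K a \<in> ?A" "ehead K a \<in> W" for a
    using that simple_path_step by (fastforce simp: arcs_ends_conv)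
  have "etail K a \<in> ?A \<longleftrightarrow> ehead K a \<in> ?A" if "a \<in> arcs (skel K \<restriction> W)" for a
    using step[of a] step[of "einv K a"] that by auto
  then have "?A = W"
    using con[unfolded connected_iff_closed[OF wf], THEN conjunct2, rule_format, of ?A] \<open>x \<in> ?A\<close>
    by auto
  then show ?thesis using xy by blast
qed

lemma awalk_of_simple_path:
  assumes "simple_path adj (everts K) x xs y"
  shows "\<exists>p. awalk x p y \<and> awalk_verts x p = xs"
  using assms
proof (induct xs arbitrary: x)
  case Nil
  then show ?case by (simp add: simple_path_def)
next
  case (Cons z xs)
  show ?case
  proof (cases xs)
    case Nil
    then show ?thesis using Cons.prems
      by (intro exI[of _ "[]"]) (auto simp: simple_path_def awalk_Nil_iff)
  next
    case (Cons u us)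
    have "simple_path adj (everts K) u xs y" "adj x u" "z = x"
      using Cons.prems Cons by (auto simp: simple_path_def)
    then obtain p a where "awalk u p y" "awalk_verts u p = xs"
      "a \<in> earcs K" "etail K a = x" "ehead K a = u"
      using Cons.hyps by blast
    then show ?thesis using \<open>z = x\<close>
      by (intro exI[of _ "a # p"]) (auto simp: awalk_Cons_iff)
  qed
qed

text \<open>
  The vertices that can be reached from \<open>a\<close> through \<open>b\<close> include \<open>b\<close> and form a closed set in the
  graph without \<open>a\<close> by \<open>reroute_through\<close>; since \<open>a\<close> is not a cut-vertex, all vertices other than
  \<open>a\<close> are among them.
\<close>

lemma ex_simple_path_through:
  assumes k2: "k_connected 2 (skel K)"
    and abc: "a \<in> everts K" "b \<in> everts K" "c \<in> everts K" "a \<noteq> b" "a \<noteq> c" "b \<noteq> c"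
  shows "\<exists>xs. simple_path adj (everts K) a xs c \<and> b \<in> set xs"
proof -
  have con: "connected (skel K \<restriction> (everts K - S))" if "S \<subseteq> everts K" "card S < 2" for S
    using k2 that by (simp add: k_connected_def)
  let ?W = "everts K - {a}"
  let ?A = "{w \<in> ?W. \<exists>xs. simple_path adj (everts K) a xs w \<and> b \<in> set xs}"
  have wf: "wf_digraph (skel K \<restriction> ?W)" by (rule wellformed_induce_subgraph)
  obtain xs where xs: "simple_path adj (everts K) a xs b"
    using ex_simple_path[of "everts K" a b] con[of "{}"] abc by auto
  moreover then have "b \<in> set xs" by (auto simp: simple_path_def)
  ultimately have bA: "b \<in> ?A" using abc by blast
  have step: "ehead K e \<in> ?A" if "e \<in> earcs K" "etail K e \<in> ?A" "ehead K e \<in> ?W" for e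
  proof (cases "ehead K e = b")
    case False
    have "ehead K e \<in> everts K" "a \<noteq> ehead K e" using that by auto
    then obtain rs where "simple_path adj (everts K - {ehead K e}) a rs b"
      using ex_simple_path[of "everts K - {ehead K e}" a b] con[of "{ehead K e}"] abc False
      by auto
    moreover have "adj (etail K e) (ehead K e)" using that by (auto simp: arcs_ends_conv)
    ultimately have "\<exists>ys. simple_path adj (everts K) a ys (ehead K e) \<and> b \<in> set ys"
      using that reroute_through[OF symp_adj, of "everts K" a _ "etail K e" b "ehead K e" rs] False
      by auto
    then show ?thesis using that by blast
  qed (use bA in simp)
  have "etail K e \<in> ?A \<longleftrightarrow> ehead K e \<in> ?A" if "e \<in> arcs (skel K \<restriction> ?W)" for e
    using step[of e] step[of "einv K e"] that by auto
  then have "?A = ?W"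
    using con[of "{a}", unfolded connected_iff_closed[OF wf], THEN conjunct2, rule_format, of ?A]
      bA abc by auto
  then show ?thesis using abc by blast
qed

end

lemma ex_cut_path:
  assumes "lopsp_operation Op"
  shows "\<exists>P. cut_path Op P"
proof -
  let ?K = "patch Op"
  have op: "embedded_graph ?K" "k_connected 2 (skel ?K)"
    "sv0 Op \<in> everts ?K" "sv1 Op \<in> everts ?K" "sv2 Op \<in> everts ?K"
    "distinct [sv0 Op, sv1 Op, sv2 Op]"
    using assms by (auto simp: lopsp_operation_def Let_def)
  interpret embedded ?K by unfold_locales (fact op)
  obtain xs where xs: "simple_path adj (everts ?K) (sv1 Op) xs (sv2 Op)" "sv0 Op \<in> set xs"
    using ex_simple_path_through[OF op(2), of "sv1 Op" "sv0 Op" "sv2 Op"] op by auto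
  then obtain p where p: "awalk (sv1 Op) p (sv2 Op)" "awalk_verts (sv1 Op) p = xs"
    using awalk_of_simple_path by blast
  then obtain q r where "p = q @ r" "awalk (sv1 Op) q (sv0 Op)" "awalk (sv0 Op) r (sv2 Op)"
    using awalk_decomp[OF p(1), of "sv0 Op"] xs(2) by auto
  then have "cut_path Op (q, r)"
    using p xs(1) by (auto simp: cut_path_def apath_def simple_path_def)
  then show ?thesis by blast
qed

section \<open>The glued graph and its sides\<close>

text \<open>
  In the following, \<open>K\<close> is the operation, \<open>B\<close> is the glued graph, that is, the barycentric subdivision
  of \<open>O(G)\<close>, \<open>H\<close> is \<open>O(G)\<close> itself, and \<open>D\<close> is the set of the oriented edges of \<open>B\<close>.
\<close>

locale gluing = K: embedded "patch Op" + G: embedded G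
  for Op :: "('w, 'b) lopsp" and G :: "('v, 'e) emb" +
  fixes P :: "'b list \<times> 'b list"
begin

abbreviation K :: "('w, 'b) emb" where "K \<equiv> patch Op"
abbreviation B :: "(('e \<times> 'b) set, 'e \<times> 'b) emb" where "B \<equiv> glued_graph Op P G"
abbreviation H :: "(('e \<times> 'b) set, 'e \<times> 'b) emb" where "H \<equiv> unsubdivide B (glued_type Op)"
abbreviation D :: "('e \<times> 'b) set" where "D \<equiv> earcs G \<times> earcs K"

lemma neighbour_chamber_in_arcs [simp]: "neighbour_chamber Op P G a d \<in> earcs G \<longleftrightarrow> d \<in> earcs G"
  using permutes_in_image[OF permutes_inv[OF G.face_succ_permutes]]
  by (simp add: neighbour_chamber_def Let_def)

lemma inj_neighbour_chamber: "inj (neighbour_chamber Op P G a)"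
proof -
  have "inj (einv G)" "inj (face_succ G)" "inj (inv (face_succ G))" "inj id"
    using permutes_inj[OF G.arev_permutes_arcs] permutes_inj[OF G.face_succ_permutes]
      permutes_inj[OF permutes_inv[OF G.face_succ_permutes]] by simp_all
  moreover have "neighbour_chamber Op P G a \<in> {einv G, face_succ G, inv (face_succ G), id}"
    unfolding neighbour_chamber_def Let_def by (simp add: fun_eq_iff)
  ultimately show ?thesis by auto
qed

lemma earcs_B [simp]: "earcs B = D"
  by (simp add: glued_graph_def Let_def)

lemma einv_B: "x \<in> D \<Longrightarrow> einv B x = (neighbour_chamber Op P G (snd x) (fst x), einv K (snd x))"
  by (cases x) (simp add: glued_graph_def Let_def perm_restrict_def)

lemma rot_B: "x \<in> D \<Longrightarrow> rot B x = (neighbour_chamber Op P G (snd x) (fst x), rot K (snd x))"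
  by (cases x) (simp add: glued_graph_def Let_def perm_restrict_def K.rot_eq_face_succ)

lemma rot_B_outside: "x \<notin> D \<Longrightarrow> rot B x = x"
  by (simp add: glued_graph_def Let_def perm_restrict_def)

lemma einv_B_in_D: "x \<in> D \<Longrightarrow> einv B x \<in> D"
  by (cases x) (auto simp: einv_B)

lemma rot_B_in_D: "x \<in> D \<Longrightarrow> rot B x \<in> D"
  by (cases x) (auto simp: rot_B)

lemma etail_B: "etail B = orbit (rot B)"
  by (simp add: glued_graph_def Let_def)

lemma ehead_B: "ehead B x = orbit (rot B) (einv B x)"
  by (simp add: glued_graph_def Let_def)

lemma everts_B: "everts B = orbit (rot B) ` D"
  by (simp add: glued_graph_def Let_def)

lemma rot_B_permutes: "rot B permutes D"
proof (rule bij_imp_permutes)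
  have "inj_on (rot B) D"
  proof (rule inj_onI)
    fix x y assume xy: "x \<in> D" "y \<in> D" and eq: "rot B x = rot B y"
    have "snd x = snd y"
      using eq rot_B[OF xy(1)] rot_B[OF xy(2)] permutes_inj[OF K.rot_permutes] by (auto dest: injD)
    moreover then have "fst x = fst y"
      using eq rot_B[OF xy(1)] rot_B[OF xy(2)] inj_neighbour_chamber by (auto dest: injD)
    ultimately show "x = y" by (rule prod_eqI[rotated])
  qed
  then show "bij_betw (rot B) D D"
    by (metis bij_betw_def endo_inj_surj finite_SigmaI G.finite_arcs K.finite_arcs image_subsetI rot_B_in_D)
qed (rule rot_B_outside)

lemma permutation_rot_B: "permutation (rot B)"
  unfolding permutation_permutes using rot_B_permutes by (intro exI[of _ D]) simp

lemma in_own_vertex: "x \<in> orbit (rot B) x"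
  using permutation_rot_B by (rule permutation_self_in_orbit)

lemma same_vertex: "y \<in> orbit (rot B) x \<Longrightarrow> orbit (rot B) y = orbit (rot B) x"
  by (meson in_own_vertex orbit_swap orbit_subset orbit_trans subsetI subset_antisym)

text \<open>
  The rotation of the glued graph covers that of the operation. Hence each of its vertices is a copy
  of one vertex of the operation, from which it inherits the type.
\<close>

lemma vertex_arcs:
  assumes "y \<in> orbit (rot B) x" "x \<in> D"
  shows "y \<in> D \<and> etail K (snd y) = etail K (snd x)"
  using assms
proof induct
  case base
  then show ?case using rot_B_in_D[of x] by (auto simp: rot_B)
next
  case (step y)
  then show ?case using rot_B_in_D[of y] by (auto simp: rot_B)
qed

lemma glued_type_vertex:
  assumes "x \<in> D" shows "glued_type Op (orbit (rot B) x) = vtype Op (etail K (snd x))"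
proof -
  have "(\<lambda>(d, a). vtype Op (etail K a)) ` orbit (rot B) x = {vtype Op (etail K (snd x))}"
  proof (intro equalityI subsetI)
    fix t assume "t \<in> (\<lambda>(d, a). vtype Op (etail K a)) ` orbit (rot B) x"
    then obtain y where "y \<in> orbit (rot B) x" "t = vtype Op (etail K (snd y))" by auto
    then show "t \<in> {vtype Op (etail K (snd x))}" using vertex_arcs[OF _ assms] by simp
  next
    fix t assume "t \<in> {vtype Op (etail K (snd x))}"
    then show "t \<in> (\<lambda>(d, a). vtype Op (etail K a)) ` orbit (rot B) x"
      using in_own_vertex[of x] by (intro image_eqI[of _ _ x]) (simp_all add: case_prod_beta)
  qed
  then show ?thesis by (simp add: glued_type_def)
qed

lemma everts_H: "everts H = orbit (rot B) ` {x \<in> D. vtype Op (etail K (snd x)) = 0}"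
  using glued_type_vertex by (auto simp: unsubdivide_def Let_def everts_B)

lemma earcs_H: "earcs H = {x \<in> D. vtype Op (etail K (snd x)) = 0 \<and> vtype Op (ehead K (snd x)) = 1}"
proof -
  have "glued_type Op (ehead B x) = vtype Op (ehead K (snd x))" if "x \<in> D" for x
    using glued_type_vertex[OF einv_B_in_D[OF that]] that by (auto simp: ehead_B einv_B)
  then show ?thesis
    using glued_type_vertex by (auto simp: unsubdivide_def Let_def etail_B)
qed

lemma etail_H: "etail H = orbit (rot B)"
  by (simp add: unsubdivide_def Let_def etail_B)

lemma ehead_H:
  assumes "x \<in> earcs H"
  shows "ehead H x = orbit (rot B) (einv B (rot B (rot B (einv B x))))"
proof -
  have "x \<in> {e \<in> earcs B. glued_type Op (etail B e) = 0 \<and> glued_type Op (ehead B e) = 1}"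
    using assms by (simp add: unsubdivide_def Let_def)
  then show ?thesis by (simp add: unsubdivide_def Let_def etail_B perm_restrict_def)
qed

end

locale edge_breaking_gluing = gluing Op G P
  for Op :: "('w, 'b) lopsp" and G :: "('v, 'e) emb" and P +
  fixes c :: 'b
  assumes op: "lopsp_operation Op" and cut: "cut_path Op P" and type_v2: "vtype Op (sv2 Op) = 0"
    and c: "c \<in> earcs K" "etail K c = sv1 Op" "ehead K c = sv2 Op"
begin

abbreviation p :: "'b list" where "p \<equiv> fst P @ snd P"

lemma distinct_special: "sv0 Op \<noteq> sv1 Op" "sv0 Op \<noteq> sv2 Op" "sv1 Op \<noteq> sv2 Op"
  and plane: "genus K = 0"
  and triangle: "\<And>f. f \<in> faces K \<Longrightarrow> card f = 3"
  and types_differ: "\<And>a. a \<in> earcs K \<Longrightarrow> vtype Op (etail K a) \<noteq> vtype Op (ehead K a)"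
  and degree_v1: "vtype Op (sv1 Op) = 1 \<Longrightarrow> card (out_arcs (skel K) (sv1 Op)) = 2"
  using op by (auto simp: lopsp_operation_def Let_def out_degree_def)

lemma walks: "K.awalk (sv1 Op) (fst P) (sv0 Op)" "K.awalk (sv0 Op) (snd P) (sv2 Op)"
  and path: "K.apath (sv1 Op) p (sv2 Op)"
  using cut by (auto simp: cut_path_def Let_def)

lemma subpaths_nonempty: "fst P \<noteq> []" "snd P \<noteq> []" "p \<noteq> []"
  using walks distinct_special by (auto simp: K.awalk_Nil_iff)

lemmas path_ends = K.apath_ends[OF path subpaths_nonempty(3)]

text \<open>
  A simple path from \<open>v\<^sub>1\<close> to \<open>v\<^sub>2\<close> that contained \<open>c\<close> would consist of \<open>c\<close> alone and miss \<open>v\<^sub>0\<close>.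
\<close>

lemma c_notin_path: "c \<notin> set p"
proof
  assume cp: "c \<in> set p"
  define f where "f = hd (fst P)"
  define l where "l = last (snd P)"
  have f: "f \<in> set (fst P)" "etail K f = sv1 Op"
    using subpaths_nonempty(1) walks(1) K.cas_simp[of "fst P"] by (auto simp: f_def K.awalk_def)
  have l: "l \<in> set (snd P)" "ehead K l = sv2 Op"
    using subpaths_nonempty(2) K.awlast_of_awalk[OF walks(2)]
    by (auto simp: l_def K.awalk_verts_conv)
  have "f = c" using inj_onD[OF path_ends(1), of f c] f cp c by simp
  moreover have "l = c" using inj_onD[OF path_ends(2), of l c] l cp c by simp
  moreover have "distinct p"
    using path unfolding K.apath_def by (blast intro: K.distinct_verts_imp_distinct)
  ultimately show False using f l by auto
qed

lemma type_v1: "vtype Op (sv1 Op) \<noteq> 0"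
  using types_differ[OF c(1)] c type_v2 by simp

text \<open>
  The half-edges of \<open>O(G)\<close> run from type 0 to type 1. One that ended at a copy of \<open>v\<^sub>1\<close> could lead
  from one side of the copies of \<open>c\<close> to the other, but there are none except those from copies of \<open>v\<^sub>2\<close>: if
  \<open>v\<^sub>1\<close> has type 1, its degree is 2, so the face on the left of \<open>a\<close> is a triangle on \<open>v\<^sub>2\<close>, \<open>v\<^sub>1\<close> and
  the tail of \<open>a\<close>. As \<open>v\<^sub>2\<close> has type 0, that tail has a different type.
\<close>

lemma no_half_edge_to_v1:
  assumes a: "a \<in> earcs K" "ehead K a = sv1 Op" "etail K a \<noteq> sv2 Op"
    "vtype Op (etail K a) = 0"
  shows "vtype Op (sv1 Op) \<noteq> 1"
proof
  assume t1: "vtype Op (sv1 Op) = 1"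
  let ?O = "out_arcs (skel K) (sv1 Op)"
  have ne: "einv K a \<noteq> c" using a c by (metis K.head_arev)
  have "{c, einv K a} \<subseteq> ?O" using a c by auto
  then have O: "?O = {c, einv K a}"
    using card_subset_eq[OF K.finite_out_arcs, of "{c, einv K a}" "sv1 Op"] degree_v1[OF t1] ne by simp
  have "rot K (einv K a) \<noteq> einv K a"
  proof
    assume fixed: "rot K (einv K a) = einv K a"
    have "c \<in> {einv K a}"
    proof (rule K.rot_closed_at_vertex[of "{einv K a}" "einv K a"])
      show "rot K x \<in> {einv K a}" if "x \<in> {einv K a}" for x
        using that fixed by (metis singletonD singletonI)
    qed (use a c in simp_all)
    then show False using ne by simp
  qed
  moreover have "rot K (einv K a) \<in> ?O" using a by simp
  ultimately have ac: "face_succ K a = c" using O by (auto simp: face_succ_def)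
  let ?b = "face_succ K c" and ?F = "orbit (face_succ K) a"
  have b: "?b \<in> earcs K" "etail K ?b = sv2 Op" using c by auto
  have "a \<in> ?F" "c \<in> ?F" "?b \<in> ?F" "face_succ K ?b \<in> ?F"
    using K.in_own_face[of a] orbit.base[of "face_succ K" a] orbit.step[of _ "face_succ K" a] ac by metis+
  moreover have "a \<noteq> c" "a \<noteq> ?b" "c \<noteq> ?b" using a c b distinct_special by metis+
  then have "card {a, c, ?b} = 3" by simp
  moreover have F3: "card ?F = 3" using triangle a(1) by (simp add: faces_def)
  ultimately have "?F = {a, c, ?b}"
    using card_subset_eq[of ?F "{a, c, ?b}"] card_ge_0_finite[of ?F] by auto
  moreover have "vtype Op (etail K (face_succ K ?b)) \<noteq> 0"
    using types_differ[OF b(1)] b type_v2 by simp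
  ultimately have "face_succ K ?b = c"
    using \<open>face_succ K ?b \<in> ?F\<close> a(4) b(2) type_v2 by auto
  then have "?b = a" using ac permutes_inj[OF K.face_succ_permutes] by (auto dest: injD)
  then show False using b(2) a(3) by simp
qed

text \<open>
  Each face of \<open>G\<close> has only one copy of \<open>v\<^sub>2\<close>, its centre: which copy \<open>x\<close> starts at depends only on
  the face. At \<open>v\<^sub>2\<close> only the last edge of the cut-path leads to a different double chamber, the
  neighbouring one in the same face.
\<close>

lemma copies_of_v2:
  obtains h where "\<And>x. x \<in> D \<Longrightarrow> etail K (snd x) = sv2 Op \<Longrightarrow>
    orbit (rot B) x = h (orbit (face_succ G) (fst x))"
proof -
  define l where "l = last (snd P)"
  have l: "l \<in> set (snd P)" "ehead K l = sv2 Op" "l \<in> earcs K"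
    using subpaths_nonempty(2) K.awlast_of_awalk[OF walks(2)] walks(2)
    by (auto simp: l_def K.awalk_verts_conv K.awalk_def)
  let ?b = "einv K l"
  have b: "?b \<in> earcs K" "etail K ?b = sv2 Op" using l by auto
  have out_notin: "a \<notin> set p" if "etail K a = sv2 Op" for a
    using path_ends(3) that by (metis imageI)
  have in_eq: "a = ?b" if "etail K a = sv2 Op" "einv K a \<in> set p" "a \<in> earcs K" for a
    using inj_onD[OF path_ends(2), of "einv K a" l] that l by (auto simp: K.arev_eq_iff)
  have "distinct p"
    using path unfolding K.apath_def by (blast intro: K.distinct_verts_imp_distinct)
  then have l1: "l \<notin> set (fst P)" using l(1) by auto
  have nb_b: "neighbour_chamber Op P G ?b d = inv (face_succ G) d" for d
    using out_notin[OF b(2)] l(1) l1 by (simp add: neighbour_chamber_def Let_def)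
  have nb: "neighbour_chamber Op P G a d = d" if "a \<in> earcs K" "etail K a = sv2 Op" "a \<noteq> ?b" for a d
    using out_notin[OF that(2)] in_eq[OF that(2) _ that(1)] that(3)
    by (auto simp: neighbour_chamber_def Let_def)
  \<comment> \<open>One step from \<open>?b\<close>, the way back along the cut-path, leads from the double chamber of the
    successor of \<open>d\<close> into that of \<open>d\<close>; further turning stays there until all arcs at \<open>v\<^sub>2\<close> have
    been met.\<close>
  have turn: "(d, a) \<in> orbit (rot B) (face_succ G d, ?b)"
    if d: "d \<in> earcs G" and a: "a \<in> earcs K" "etail K a = sv2 Op" for d a
  proof -
    have "inv (face_succ G) (face_succ G d) = d"
      using permutes_inverses(2)[OF G.face_succ_permutes] .
    then have start: "rot B (face_succ G d, ?b) = (d, rot K ?b)"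
      using d b(1) by (simp add: rot_B nb_b)
    let ?M = "{a \<in> earcs K. etail K a = sv2 Op \<and> (d, a) \<in> orbit (rot B) (face_succ G d, ?b)}"
    have "rot K ?b \<in> ?M"
      using start orbit.base[of "rot B" "(face_succ G d, ?b)"] b by simp
    moreover have "rot K a \<in> ?M" if "a \<in> ?M" for a
    proof (cases "a = ?b")
      case False
      then have "rot B (d, a) = (d, rot K a)" using that d by (simp add: rot_B nb)
      then show ?thesis using that orbit.step[of "(d, a)" "rot B"] by simp
    qed (use \<open>rot K ?b \<in> ?M\<close> in simp)
    ultimately have "a \<in> ?M"
      using b a by (intro K.rot_closed_at_vertex[of ?M "rot K ?b" a]) simp_all
    then show ?thesis by simp
  qed
  define v where "v d = orbit (rot B) (d, ?b)" for d
  have at_v2: "orbit (rot B) (d, a) = v (face_succ G d)"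
    if "d \<in> earcs G" "a \<in> earcs K" "etail K a = sv2 Op" for d a
    using same_vertex[OF turn[OF that]] by (simp add: v_def)
  have v_succ: "v (face_succ G d) = v d" if "d \<in> earcs G" for d
    using at_v2[OF that b] by (simp add: v_def)
  have v_face: "d' \<in> earcs G \<and> v d' = v d" if "d' \<in> orbit (face_succ G) d" "d \<in> earcs G" for d d'
    using that by induct (simp_all add: v_succ)
  show thesis
  proof (rule that[of "\<lambda>f. v (SOME d. d \<in> f)"])
    fix x assume x: "x \<in> D" "etail K (snd x) = sv2 Op"
    let ?d = "SOME d. d \<in> orbit (face_succ G) (fst x)"
    have "?d \<in> orbit (face_succ G) (fst x)" using G.in_own_face by (rule someI)
    then have "v ?d = v (fst x)" using v_face x(1) by auto
    then show "orbit (rot B) x = v ?d"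
      using at_v2[of "fst x" "snd x"] v_succ x by auto
  qed
qed

text \<open>
  The label of \<open>(d, a)\<close> is the vertex of \<open>G\<close> around whose disc \<open>(d, a)\<close> lies: the head of \<open>d\<close> if \<open>a\<close>
  lies on the left of the cut-path, and the tail otherwise. Only crossing a copy of \<open>c\<close> changes it.
  Crossing the part of the cut-path between \<open>v\<^sub>1\<close> and \<open>v\<^sub>0\<close> leads from \<open>d\<close> to its inverse, and crossing
  the part between \<open>v\<^sub>0\<close> and \<open>v\<^sub>2\<close> leads to the successor or the predecessor of \<open>d\<close> in its face. In
  each case the side is exchanged, and the end of \<open>d\<close> in question is the opposite end of the new
  oriented edge.
\<close>

lemma ex_label:
  obtains s :: "'e \<times> 'b \<Rightarrow> 'v" where
    "\<And>x. x \<in> D \<Longrightarrow> snd x \<noteq> c \<Longrightarrow> einv K (snd x) \<noteq> c \<Longrightarrow> s (einv B x) = s x"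
    "\<And>x. x \<in> D \<Longrightarrow> snd x \<noteq> c \<Longrightarrow> einv K (snd x) \<noteq> c \<Longrightarrow> s (rot B x) = s x"
    "\<And>a. (\<forall>d \<in> earcs G. s (d, a) = ehead G d) \<or> (\<forall>d \<in> earcs G. s (d, a) = etail G d)"
proof -
  obtain L where L: "\<And>a. a \<in> earcs K \<Longrightarrow> face_succ K a \<in> L \<longleftrightarrow> a \<in> L"
    "\<And>a. a \<in> set p \<Longrightarrow> a \<in> L \<and> einv K a \<notin> L"
    "\<And>a. a \<in> earcs K \<Longrightarrow> a \<notin> set p \<Longrightarrow> einv K a \<notin> set p \<Longrightarrow> a \<noteq> c \<Longrightarrow> einv K a \<noteq> c \<Longrightarrow>
      einv K a \<in> L \<longleftrightarrow> a \<in> L"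
    by (rule K.cycle_sides[OF plane path subpaths_nonempty(3) c c_notin_path]) blast
  define s where "s x = (if snd x \<in> L then ehead G (fst x) else etail G (fst x))" for x
  have inv: "s (einv B x) = s x" if x: "x \<in> D" "snd x \<noteq> c" "einv K (snd x) \<noteq> c" for x
  proof -
    obtain d a where da: "x = (d, a)" "d \<in> earcs G" "a \<in> earcs K" using x(1) by auto
    let ?a = "einv K a"
    have onto: "face_succ G (inv (face_succ G) d) = d"
      using permutes_inverses(1)[OF G.face_succ_permutes] .
    have pred: "inv (face_succ G) d \<in> earcs G"
      using permutes_in_image[OF permutes_inv[OF G.face_succ_permutes]] da(2) by simp
    have "ehead G (inv (face_succ G) d) = etail G d"
      using G.tail_face_succ[OF pred] onto by simp
    then have bwd: "s (inv (face_succ G) d, ?a) = s (d, a)" if "?a \<in> set (snd P)"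
      using L(2)[of ?a] that by (simp add: s_def)
    have fwd: "s (face_succ G d, ?a) = s (d, a)" if "a \<in> set (snd P)"
      using L(2)[of a] that da by (simp add: s_def)
    have across: "s (einv G d, ?a) = s (d, a)" if "a \<in> set (fst P) \<or> ?a \<in> set (fst P)"
      using L(2)[of a] L(2)[of ?a] that da by (auto simp: s_def)
    have stay: "s (d, ?a) = s (d, a)" if "a \<notin> set p" "?a \<notin> set p"
      using L(3)[OF da(3) that] x da by (simp add: s_def)
    show ?thesis
      using across bwd fwd stay
      unfolding einv_B[OF x(1)] unfolding da(1) neighbour_chamber_def Let_def by auto
  qed
  have rot: "s (rot B x) = s x" if x: "x \<in> D" "snd x \<noteq> c" "einv K (snd x) \<noteq> c" for x
  proof -
    have "rot K (snd x) \<in> L \<longleftrightarrow> einv K (snd x) \<in> L"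
      using L(1)[of "einv K (snd x)"] x(1) by (auto simp: K.rot_eq_face_succ)
    then have "s (rot B x) = s (einv B x)" by (simp add: s_def rot_B[OF x(1)] einv_B[OF x(1)])
    then show ?thesis using inv[OF x] by simp
  qed
  have "(\<forall>d \<in> earcs G. s (d, a) = ehead G d) \<or> (\<forall>d \<in> earcs G. s (d, a) = etail G d)" for a
    by (cases "a \<in> L") (simp_all add: s_def)
  then show thesis using that inv rot by blast
qed

text \<open>
  The vertices deleted are the copies of \<open>v\<^sub>2\<close>. Labels change only at copies of \<open>c\<close>, which join type
  1 or 2 to deleted vertices. So labels are constant at each remaining vertex of \<open>H\<close>, and along each
  remaining edge by \<open>no_half_edge_to_v1\<close>. If a vertex remains, then so do the copies of the same vertex
  of the operation in the double chambers of \<open>d\<^sub>0\<close> and its inverse, and these have different labels.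
\<close>

lemma not_3_connected:
  assumes faces: "card (faces G) \<le> 2" and no_loop: "d\<^sub>0 \<in> earcs G" "etail G d\<^sub>0 \<noteq> ehead G d\<^sub>0"
  shows "\<not> k_connected 3 (skel H)"
proof
  assume k3: "k_connected 3 (skel H)"
  let ?S = "orbit (rot B) ` {x \<in> D. etail K (snd x) = sv2 Op}"
  let ?W = "everts H - ?S"
  obtain h where h: "\<And>x. x \<in> D \<Longrightarrow> etail K (snd x) = sv2 Op \<Longrightarrow>
      orbit (rot B) x = h (orbit (face_succ G) (fst x))"
    using copies_of_v2 by blast
  have "?S \<subseteq> h ` faces G"
    using h by (auto simp: faces_def)
  moreover have finF: "finite (faces G)" by (simp add: faces_def)
  ultimately have "card ?S \<le> card (faces G)" by (meson surj_card_le)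
  then have "card ?S < 3" using faces by simp
  moreover have "?S \<subseteq> everts H" using type_v2 by (auto simp: everts_H)
  ultimately have con: "connected (skel H \<restriction> ?W)" using k3 by (simp add: k_connected_def)
  obtain s :: "'e \<times> 'b \<Rightarrow> 'v" where
    s: "\<And>x. x \<in> D \<Longrightarrow> snd x \<noteq> c \<Longrightarrow> einv K (snd x) \<noteq> c \<Longrightarrow> s (einv B x) = s x"
      "\<And>x. x \<in> D \<Longrightarrow> snd x \<noteq> c \<Longrightarrow> einv K (snd x) \<noteq> c \<Longrightarrow> s (rot B x) = s x"
    and s_ends: "\<And>a. (\<forall>d \<in> earcs G. s (d, a) = ehead G d) \<or> (\<forall>d \<in> earcs G. s (d, a) = etail G d)"
    using ex_label by blast
  have off_c: "snd x \<noteq> c \<and> einv K (snd x) \<noteq> c"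
    if "x \<in> D" "etail K (snd x) \<noteq> sv1 Op" "etail K (snd x) \<noteq> sv2 Op" for x
    using that c K.arev_arev[of "snd x"] K.tail_arev[OF c(1)] by metis
  have s_vertex: "s y = s x"
    if "y \<in> orbit (rot B) x" "x \<in> D" "etail K (snd x) \<noteq> sv1 Op" "etail K (snd x) \<noteq> sv2 Op" for x y
    using that
  proof induct
    case base
    then show ?case using s(2)[of x] off_c[of x] by simp
  next
    case (step y)
    then show ?case using s(2)[of y] off_c[of y] vertex_arcs[of y x] by simp
  qed
  have W: "X \<in> ?W \<longleftrightarrow> (\<exists>x. X = orbit (rot B) x \<and> x \<in> D \<and> vtype Op (etail K (snd x)) = 0 \<and>
      etail K (snd x) \<noteq> sv1 Op \<and> etail K (snd x) \<noteq> sv2 Op)" (is "_ \<longleftrightarrow> ?R X") for X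
  proof
    assume "X \<in> ?W"
    then obtain x where x: "X = orbit (rot B) x" "x \<in> D" "vtype Op (etail K (snd x)) = 0" "X \<notin> ?S"
      by (auto simp: everts_H)
    then have "etail K (snd x) \<noteq> sv2 Op" by blast
    moreover have "etail K (snd x) \<noteq> sv1 Op" using x(3) type_v1 by metis
    ultimately show "?R X" using x by blast
  next
    assume "?R X"
    then obtain x where x: "X = orbit (rot B) x" "x \<in> D" "vtype Op (etail K (snd x)) = 0"
      "etail K (snd x) \<noteq> sv2 Op" by blast
    have "X \<notin> ?S"
    proof
      assume "X \<in> ?S"
      then obtain y where "y \<in> D" "etail K (snd y) = sv2 Op" "X = orbit (rot B) y" by auto
      then show False using vertex_arcs[of x y] in_own_vertex[of x] x by simp
    qed
    then show "X \<in> ?W" using x by (auto simp: everts_H)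
  qed
  \<comment> \<open>The second end of an edge of \<open>H\<close> is reached through its middle, a vertex of type 1; neither
    half crosses a copy of \<open>c\<close>.\<close>
  have half: "s (einv B (rot B (rot B (einv B x)))) = s x"
    if x: "x \<in> earcs H" "etail K (snd x) \<noteq> sv2 Op" for x
  proof -
    have D: "x \<in> D" "snd x \<in> earcs K" and t: "vtype Op (etail K (snd x)) = 0" "vtype Op (ehead K (snd x)) = 1"
      using x(1) by (auto simp: earcs_H)
    have tail: "etail K (snd x) \<noteq> sv1 Op" using t(1) type_v1 by auto
    have head: "ehead K (snd x) \<noteq> sv1 Op" "ehead K (snd x) \<noteq> sv2 Op"
      using no_half_edge_to_v1[OF D(2) _ x(2) t(1)] t(2) type_v2 by auto
    let ?y = "einv B x"
    let ?z = "rot B (rot B ?y)"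
    have y: "?y \<in> D" "etail K (snd ?y) = ehead K (snd x)"
      using einv_B_in_D[OF D(1)] D by (auto simp: einv_B)
    have zy: "?z \<in> orbit (rot B) ?y" by (intro orbit.step orbit.base)
    have z: "?z \<in> D" "etail K (snd ?z) = ehead K (snd x)"
      using vertex_arcs[OF zy y(1)] y(2) by auto
    have "s (einv B ?z) = s ?z" using s(1)[OF z(1)] off_c[OF z(1)] head z(2) by simp
    also have "\<dots> = s ?y" using s_vertex[OF zy y(1)] head y(2) by simp
    also have "\<dots> = s x" using s(1)[OF D(1)] off_c[OF D(1) tail x(2)] by simp
    finally show ?thesis .
  qed
  have wf: "wf_digraph (skel H \<restriction> ?W)"
    unfolding wf_digraph_def by simp
  have "?W \<noteq> {}" using con connected_iff_closed[OF wf] by simp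
  then obtain X where X: "X \<in> ?W" by (rule exE[OF ex_in_conv[THEN iffD2]])
  obtain x where Xx: "X = orbit (rot B) x" and x: "x \<in> D" "vtype Op (etail K (snd x)) = 0"
    "etail K (snd x) \<noteq> sv1 Op" "etail K (snd x) \<noteq> sv2 Op"
    using W[THEN iffD1, OF X] by (elim exE conjE)
  have xW: "orbit (rot B) x \<in> ?W" using X unfolding Xx .
  let ?A = "{X \<in> ?W. \<exists>y \<in> X. s y = s x}"
  have in_A: "orbit (rot B) y \<in> ?A \<longleftrightarrow> s y = s x" if y: "orbit (rot B) y \<in> ?W" "y \<in> D" for y
  proof -
    obtain z where z: "orbit (rot B) y = orbit (rot B) z" "z \<in> D"
      "etail K (snd z) \<noteq> sv1 Op" "etail K (snd z) \<noteq> sv2 Op"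
      using W[THEN iffD1, OF y(1)] by (elim exE conjE)
    have "s u = s y" if "u \<in> orbit (rot B) y" for u
    proof -
      have "u \<in> orbit (rot B) z" "y \<in> orbit (rot B) z"
        using that in_own_vertex[of y] by (simp_all only: z(1)[symmetric])
      then show ?thesis using s_vertex[OF _ z(2-4)] by metis
    qed
    then have "(\<exists>u \<in> orbit (rot B) y. s u = s x) \<longleftrightarrow> s y = s x"
      using in_own_vertex[of y] by metis
    then show ?thesis using y(1) by (simp only: mem_Collect_eq simp_thms)
  qed
  have "tail (skel H \<restriction> ?W) e \<in> ?A \<longleftrightarrow> head (skel H \<restriction> ?W) e \<in> ?A"
    if e: "e \<in> arcs (skel H \<restriction> ?W)" for e
  proof -
    have eH: "e \<in> earcs H" and ends: "etail H e \<in> ?W" "ehead H e \<in> ?W" using e by auto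
    have eD: "e \<in> D" using eH by (simp add: earcs_H)
    have "etail K (snd e) \<noteq> sv2 Op"
      using ends(1) eD unfolding etail_H by blast
    then have se: "s (einv B (rot B (rot B (einv B e)))) = s e" using half eH by blast
    have "einv B (rot B (rot B (einv B e))) \<in> D"
      by (intro einv_B_in_D rot_B_in_D eD)
    then have "ehead H e \<in> ?A \<longleftrightarrow> s e = s x"
      using in_A ends(2) se unfolding ehead_H[OF eH] by simp
    moreover have "etail H e \<in> ?A \<longleftrightarrow> s e = s x"
      using in_A[of e] ends(1) eD unfolding etail_H by simp
    ultimately show ?thesis by simp
  qed
  then have closed: "\<forall>e \<in> arcs (skel H \<restriction> ?W).
      tail (skel H \<restriction> ?W) e \<in> ?A \<longleftrightarrow> head (skel H \<restriction> ?W) e \<in> ?A" by (rule ballI)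
  have "?A \<noteq> {}" using in_A[OF xW x(1)] by (metis empty_iff)
  moreover have "?A \<subseteq> verts (skel H \<restriction> ?W)" unfolding induce_subgraph_verts by (rule Collect_restrict)
  ultimately have all: "?A = ?W"
    using con[unfolded connected_iff_closed[OF wf]] closed unfolding induce_subgraph_verts by meson
  have "\<exists>d \<in> earcs G. s (d, snd x) \<noteq> s x"
  proof -
    have d0: "ehead G (einv G d\<^sub>0) = etail G d\<^sub>0" "etail G (einv G d\<^sub>0) = ehead G d\<^sub>0"
      "einv G d\<^sub>0 \<in> earcs G" using no_loop by auto
    have "s (d\<^sub>0, snd x) \<noteq> s (einv G d\<^sub>0, snd x)"
      using s_ends[of "snd x"] d0 no_loop by metis
    then show ?thesis using d0(3) no_loop(1) by metis
  qed
  then obtain d where d: "d \<in> earcs G" "s (d, snd x) \<noteq> s x" by blast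
  let ?y = "(d, snd x)"
  have y: "?y \<in> D" using d x(1) by auto
  have yW: "orbit (rot B) ?y \<in> ?W"
    unfolding W using y x by (intro exI[of _ ?y]) simp
  then have "orbit (rot B) ?y \<in> ?A" unfolding all .
  then have "s ?y = s x" by (rule in_A[OF yW y, THEN iffD1])
  then show False using d(2) by contradiction
qed

end

section \<open>Wheels with two faces\<close>

lemma cyclic_onI:
  assumes "s \<in> S" "\<And>x. x \<in> S \<Longrightarrow> f x \<in> S"
    and "\<And>T x. f s \<in> T \<Longrightarrow> (\<And>x. x \<in> T \<Longrightarrow> f x \<in> T) \<Longrightarrow> x \<in> S \<Longrightarrow> x \<in> T"
  shows "cyclic_on f S"
proof -
  have "x \<in> S" if "x \<in> orbit f s" for x
    using that by induct (simp_all add: assms(1,2))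
  moreover have "x \<in> orbit f s" if "x \<in> S" for x
    using orbit.base orbit.step that by (rule assms(3))
  ultimately have "S = orbit f s" by blast
  then show ?thesis using assms(1) unfolding cyclic_on_def by blast
qed

text \<open>
  The wheel has the rim vertices \<open>0, \<dots>, n - 1\<close> and the hub \<open>n\<close>. Its arcs are numbered so that
  \<open>a div 4\<close> is the rim vertex of a spoke or the tail of a rim arc, and \<open>a mod 4\<close> tells the kind of the
  arc: from the hub, to the hub, to the next rim vertex, to the previous rim vertex.
\<close>

definition to_rim :: "nat \<Rightarrow> nat" where "to_rim i = 4 * i"
definition to_hub :: "nat \<Rightarrow> nat" where "to_hub i = 4 * i + 1"
definition rim_fwd :: "nat \<Rightarrow> nat" where "rim_fwd i = 4 * i + 2"
definition rim_bwd :: "nat \<Rightarrow> nat" where "rim_bwd i = 4 * i + 3"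

definition next_rim :: "nat \<Rightarrow> nat \<Rightarrow> nat" where
  "next_rim n i = (if Suc i = n then 0 else Suc i)"

definition prev_rim :: "nat \<Rightarrow> nat \<Rightarrow> nat" where
  "prev_rim n i = (if i = 0 then n - 1 else i - 1)"

definition wheel_inv :: "nat \<Rightarrow> nat \<Rightarrow> nat" where
  "wheel_inv n a = (let i = a div 4 in
     if a \<ge> 4 * n then a
     else [to_hub i, to_rim i, rim_bwd (next_rim n i), rim_fwd (prev_rim n i)] ! (a mod 4))"

text \<open>
  Relative to the hub, the rotation at the rim vertices is the mirror image of that in the planar
  wheel, where it would be the inverse cycle.
\<close>

definition wheel_rot :: "nat \<Rightarrow> nat \<Rightarrow> nat" where
  "wheel_rot n a = (let i = a div 4 in
     if a \<ge> 4 * n then a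
     else [to_rim (next_rim n i), rim_fwd i, rim_bwd i, to_hub i] ! (a mod 4))"

definition wheel_tail :: "nat \<Rightarrow> nat \<Rightarrow> nat" where
  "wheel_tail n a = (if a mod 4 = 0 then n else a div 4)"

definition wheel :: "nat \<Rightarrow> (nat, nat) emb" where
  "wheel n = \<lparr> skel = \<lparr> verts = {..n}, arcs = {..<4 * n}, tail = wheel_tail n,
                         head = \<lambda>a. wheel_tail n (wheel_inv n a) \<rparr>,
               einv = wheel_inv n, rot = wheel_rot n \<rparr>"

lemma wheel_arc_cases:
  assumes "a < 4 * n"
  obtains i where "i < n" "a = to_rim i" | i where "i < n" "a = to_hub i"
    | i where "i < n" "a = rim_fwd i" | i where "i < n" "a = rim_bwd i"
proof -
  have a: "a = 4 * (a div 4) + a mod 4" "a div 4 < n" using assms by auto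
  have "a mod 4 = 0 \<or> a mod 4 = 1 \<or> a mod 4 = 2 \<or> a mod 4 = 3" by linarith
  then show thesis
    using a that unfolding to_rim_def to_hub_def rim_fwd_def rim_bwd_def by (metis add.right_neutral)
qed

lemma wheel_arc_simps [simp]:
  "to_rim i < 4 * n \<longleftrightarrow> i < n" "to_hub i < 4 * n \<longleftrightarrow> i < n"
  "rim_fwd i < 4 * n \<longleftrightarrow> i < n" "rim_bwd i < 4 * n \<longleftrightarrow> i < n"
  "to_rim i = to_rim j \<longleftrightarrow> i = j" "to_hub i = to_hub j \<longleftrightarrow> i = j"
  "rim_fwd i = rim_fwd j \<longleftrightarrow> i = j" "rim_bwd i = rim_bwd j \<longleftrightarrow> i = j"
  "to_rim i \<noteq> to_hub j" "to_rim i \<noteq> rim_fwd j" "to_rim i \<noteq> rim_bwd j"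
  "to_hub i \<noteq> to_rim j" "to_hub i \<noteq> rim_fwd j" "to_hub i \<noteq> rim_bwd j"
  "rim_fwd i \<noteq> to_rim j" "rim_fwd i \<noteq> to_hub j" "rim_fwd i \<noteq> rim_bwd j"
  "rim_bwd i \<noteq> to_rim j" "rim_bwd i \<noteq> to_hub j" "rim_bwd i \<noteq> rim_fwd j"
  unfolding to_rim_def to_hub_def rim_fwd_def rim_bwd_def by presburger+

lemma div_mod_wheel_arc:
  "to_rim i div 4 = i" "to_rim i mod 4 = 0" "to_hub i div 4 = i" "to_hub i mod 4 = 1"
  "rim_fwd i div 4 = i" "rim_fwd i mod 4 = 2" "rim_bwd i div 4 = i" "rim_bwd i mod 4 = 3"
  unfolding to_rim_def to_hub_def rim_fwd_def rim_bwd_def by presburger+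

lemma next_rim_simps [simp]:
  assumes "i < n"
  shows "next_rim n i < n" "prev_rim n i < n" "next_rim n (prev_rim n i) = i"
    "prev_rim n (next_rim n i) = i"
  using assms by (auto simp: next_rim_def prev_rim_def)

lemma next_rim_inj [simp]:
  assumes "i < n" "j < n"
  shows "next_rim n i = next_rim n j \<longleftrightarrow> i = j" "prev_rim n i = prev_rim n j \<longleftrightarrow> i = j"
  using assms by (auto simp: next_rim_def prev_rim_def split: if_splits)

lemma next_rim_neq:
  assumes "i < n" "n \<ge> 3"
  shows "next_rim n i \<noteq> i" "prev_rim n i \<noteq> i" "next_rim n i \<noteq> prev_rim n i"
  using assms by (auto simp: next_rim_def prev_rim_def split: if_splits)

lemma wheel_inv_simps [simp]:
  assumes "i < n"
  shows "wheel_inv n (to_rim i) = to_hub i" "wheel_inv n (to_hub i) = to_rim i"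
    "wheel_inv n (rim_fwd i) = rim_bwd (next_rim n i)" "wheel_inv n (rim_bwd i) = rim_fwd (prev_rim n i)"
  using assms wheel_arc_simps(1-4)[of i n]
  by (simp_all add: wheel_inv_def div_mod_wheel_arc Let_def not_le[symmetric] numeral_2_eq_2 numeral_3_eq_3)

lemma wheel_rot_simps [simp]:
  assumes "i < n"
  shows "wheel_rot n (to_rim i) = to_rim (next_rim n i)" "wheel_rot n (to_hub i) = rim_fwd i"
    "wheel_rot n (rim_fwd i) = rim_bwd i" "wheel_rot n (rim_bwd i) = to_hub i"
  using assms wheel_arc_simps(1-4)[of i n]
  by (simp_all add: wheel_rot_def div_mod_wheel_arc Let_def not_le[symmetric] numeral_2_eq_2 numeral_3_eq_3)

lemma wheel_tail_simps [simp]: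
  "wheel_tail n (to_rim i) = n" "wheel_tail n (to_hub i) = i"
  "wheel_tail n (rim_fwd i) = i" "wheel_tail n (rim_bwd i) = i"
  by (simp_all add: wheel_tail_def div_mod_wheel_arc)

lemma wheel_sel [simp]:
  "everts (wheel n) = {..n}" "earcs (wheel n) = {..<4 * n}" "etail (wheel n) = wheel_tail n"
  "ehead (wheel n) a = wheel_tail n (wheel_inv n a)" "einv (wheel n) = wheel_inv n"
  "rot (wheel n) = wheel_rot n"
  by (simp_all add: wheel_def)

lemma wheel_inv_outside: "\<not> a < 4 * n \<Longrightarrow> wheel_inv n a = a"
  by (simp add: wheel_inv_def Let_def)

lemma wheel_rot_outside: "\<not> a < 4 * n \<Longrightarrow> wheel_rot n a = a"
  by (simp add: wheel_rot_def Let_def)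

lemma wheel_tail_le: "a < 4 * n \<Longrightarrow> wheel_tail n a \<le> n"
  by (erule wheel_arc_cases) auto

lemma wheel_inv_less: "a < 4 * n \<Longrightarrow> wheel_inv n a < 4 * n"
  by (erule wheel_arc_cases) auto

lemma wheel_rot_less: "a < 4 * n \<Longrightarrow> wheel_rot n a < 4 * n"
  by (erule wheel_arc_cases) auto

lemma wheel_inv_inv: "a < 4 * n \<Longrightarrow> wheel_inv n (wheel_inv n a) = a"
  by (erule wheel_arc_cases) auto

lemma wheel_inv_neq: "a < 4 * n \<Longrightarrow> wheel_inv n a \<noteq> a"
  by (erule wheel_arc_cases) auto

lemma wheel_rot_permutes: "wheel_rot n permutes {..<4 * n}"
proof (rule bij_imp_permutes)
  have "inj_on (wheel_rot n) {..<4 * n}"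
  proof (rule inj_onI)
    fix a b assume "a \<in> {..<4 * n}" "b \<in> {..<4 * n}" "wheel_rot n a = wheel_rot n b"
    then show "a = b"
      by (elim lessThan_iff[THEN iffD1, elim_format] wheel_arc_cases) auto
  qed
  then show "bij_betw (wheel_rot n) {..<4 * n} {..<4 * n}"
    using wheel_rot_less by (intro bij_betw_imageI endo_inj_surj) auto
qed (use wheel_rot_outside in auto)

lemma wheel_out_arcs:
  "out_arcs (skel (wheel n)) n = to_rim ` {..<n}"
  "i < n \<Longrightarrow> out_arcs (skel (wheel n)) i = {to_hub i, rim_fwd i, rim_bwd i}"
proof -
  have "a \<in> to_rim ` {..<n} \<longleftrightarrow> wheel_tail n a = n" if "a < 4 * n" for a
    using that by (rule wheel_arc_cases) auto
  then show "out_arcs (skel (wheel n)) n = to_rim ` {..<n}" by (auto simp: out_arcs_def)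
  have "a \<in> {to_hub i, rim_fwd i, rim_bwd i} \<longleftrightarrow> wheel_tail n a = i" if "a < 4 * n" "i < n" for a
    using that(1) by (rule wheel_arc_cases) (use that(2) in auto)
  then show "out_arcs (skel (wheel n)) i = {to_hub i, rim_fwd i, rim_bwd i}" if "i < n"
    using that by (auto simp: out_arcs_def)
qed

text \<open>
  If the hub remains, every remaining rim vertex is adjacent to it. Otherwise at most one rim vertex
  \<open>j\<close> is missing, and the other ones form a path that starts after \<open>j\<close>.
\<close>

lemma wheel_connected_deleted:
  assumes W: "W \<subseteq> {..n}" and n: "n \<ge> 3" and S: "card ({..n} - W) < 3"
  shows "connected (skel (wheel n) \<restriction> W)"
proof -
  let ?S = "{..n} - W"
  have wf: "wf_digraph (skel (wheel n))"
    by unfold_locales (auto simp: wheel_tail_le wheel_inv_less)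
  interpret wf_digraph "skel (wheel n)" by (fact wf)
  have "W \<noteq> {}"
  proof
    assume "W = {}"
    then show False using S n by simp
  qed
  moreover have "A = W" if A: "A \<subseteq> W" "A \<noteq> {}"
    and cl: "\<forall>a \<in> arcs (skel (wheel n) \<restriction> W). wheel_tail n a \<in> A \<longleftrightarrow> wheel_tail n (wheel_inv n a) \<in> A" for A
  proof -
    have spoke: "i \<in> A \<longleftrightarrow> n \<in> A" if "i < n" "i \<in> W" "n \<in> W" for i
      using that bspec[OF cl, of "to_hub i"] by simp
    have rim: "i \<in> A \<longleftrightarrow> next_rim n i \<in> A" if "i < n" "i \<in> W" "next_rim n i \<in> W" for i
      using that bspec[OF cl, of "rim_fwd i"] by simp
    have lt: "i < n" if "i \<in> W" "i \<noteq> n" for i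
      using that W by (metis atMost_iff le_neq_implies_less subsetD)
    show "A = W"
    proof (cases "n \<in> W")
      case True
      have "i \<in> A \<longleftrightarrow> n \<in> A" if "i \<in> W" for i
        using spoke[of i] that lt[of i] True by auto
      then show ?thesis using A by auto
    next
      case False
      have "card (?S - {n}) \<le> 1" using S False by simp
      then have "\<exists>j < n. ?S - {n} \<subseteq> {j}"
      proof (cases "?S - {n} = {}")
        case True
        then show ?thesis using n by (intro exI[of _ 0]) auto
      next
        case False
        then obtain j where j: "j \<in> ?S - {n}" by auto
        have "k = j" if "k \<in> ?S - {n}" for k
          using \<open>card (?S - {n}) \<le> 1\<close> that j card_le_Suc0_iff_eq[of "?S - {n}"] by simp
        then have "?S - {n} \<subseteq> {j}" by blast
        moreover have "j < n" using j by simp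
        ultimately show ?thesis by blast
      qed
      then obtain j where j: "j < n" "?S - {n} \<subseteq> {j}" by auto
      have inW: "i \<in> W" if "i < n" "i \<noteq> j" for i 
      proof -
        have "i \<notin> ?S - {n}" using j(2) that(2) by blast
        then show ?thesis using that(1) by simp
      qed
      define r where "r k = (j + k) mod n" for k
      have r_lt: "r k < n" for k using j by (auto simp: r_def)
      have r_Suc: "r (Suc k) = next_rim n (r k)" for k
        using r_lt[of k] unfolding r_def next_rim_def by (auto simp: mod_Suc)
      have r_neq: "r k \<noteq> j" if "0 < k" "k < n" for k
        using that j(1) by (auto simp: r_def mod_if split: if_splits)
      have all: "r (Suc k) \<in> A \<longleftrightarrow> r 1 \<in> A" if "Suc k < n" for k
        using that
      proof (induct k)
        case (Suc k)
        have "r (Suc k) \<in> A \<longleftrightarrow> r (Suc (Suc k)) \<in> A"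
          unfolding r_Suc[of "Suc k"] using Suc.prems r_lt r_neq[of "Suc k"] r_neq[of "Suc (Suc k)"] r_Suc[of "Suc k"]
          by (intro rim inW) auto
        then show ?case using Suc by simp
      qed simp
      have "i \<in> A \<longleftrightarrow> r 1 \<in> A" if i: "i \<in> W" for i
      proof (cases "i = j")
        case True
        have "r 0 = j" using j by (simp add: r_def)
        then have "next_rim n j = r 1" using r_Suc[of 0] by simp
        then show ?thesis
          using rim[of j] i j(1) True inW[OF r_lt r_neq[of 1]] n by simp
      next
        case False
        have "i < n" using lt[OF i] i \<open>n \<notin> W\<close> by auto
        define k where "k = (if j < i then i - j else i + n - j)"
        have "0 < k" "k < n" "r k = i"
          using \<open>i < n\<close> j(1) False by (auto simp: k_def r_def)
        then show ?thesis using all[of "k - 1"] by simp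
      qed
      then show ?thesis using A by auto
    qed
  qed
  ultimately show ?thesis
    by (subst connected_iff_closed[OF wellformed_induce_subgraph]) auto
qed

lemma wheel_3_connected:
  assumes "n \<ge> 3" shows "k_connected 3 (skel (wheel n))"
  unfolding k_connected_def
proof (intro conjI allI impI)
  fix S assume "S \<subseteq> everts (wheel n)" "card S < 3"
  moreover then have "{..n} - ({..n} - S) = S" by auto
  ultimately show "connected (skel (wheel n) \<restriction> (everts (wheel n) - S))"
    using assms by (intro wheel_connected_deleted) auto
qed (use assms in simp)

lemma wheel_embedded:
  assumes n: "n \<ge> 3" shows "embedded_graph (wheel n)"
proof -
  have wf: "wf_digraph (skel (wheel n))"
    by unfold_locales (auto simp: wheel_tail_le wheel_inv_less)
  have "connected (skel (wheel n) \<restriction> everts (wheel n))"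
    using n by (intro wheel_connected_deleted) auto
  moreover have "skel (wheel n) \<restriction> everts (wheel n) = skel (wheel n)"
    by (auto simp: wheel_def induce_subgraph_def wheel_tail_le wheel_inv_less)
  ultimately have "connected (skel (wheel n))" by simp
  moreover have "fin_digraph (skel (wheel n))"
    using wf by (intro wf_digraph.fin_digraphI) auto
  moreover have "bidirected_digraph (skel (wheel n)) (wheel_inv n)"
    by (rule wf_digraph.bidirected_digraphI[OF wf])
      (auto simp: wheel_inv_inv wheel_inv_neq wheel_inv_outside)
  moreover have "cyclic_on (wheel_rot n) (out_arcs (skel (wheel n)) v)" if "v \<le> n" for v
  proof (cases "v = n")
    case True
    have "cyclic_on (wheel_rot n) (to_rim ` {..<n})"
    proof (rule cyclic_onI)
      show "to_rim 0 \<in> to_rim ` {..<n}" using n by auto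
      fix T x assume T: "wheel_rot n (to_rim 0) \<in> T" "\<And>x. x \<in> T \<Longrightarrow> wheel_rot n x \<in> T"
        and x: "x \<in> to_rim ` {..<n}"
      have pos: "to_rim (Suc i) \<in> T" if "Suc i < n" for i
        using that
      proof (induct i)
        case 0
        then show ?case using T(1) n by (simp add: next_rim_def)
      next
        case (Suc i)
        then show ?case using T(2)[of "to_rim (Suc i)"] by (simp add: next_rim_def)
      qed
      have "to_rim 0 \<in> T"
        using pos[of "n - 2"] T(2)[of "to_rim (n - 1)"] n
        by (simp add: next_rim_def numeral_2_eq_2 Suc_diff_Suc)
      then have "to_rim i \<in> T" if "i < n" for i using pos that by (cases i) auto
      then show "x \<in> T" using x by auto
    qed auto
    then show ?thesis using True wheel_out_arcs(1) by simp
  next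
    case False
    then have v: "v < n" using that by simp
    have "cyclic_on (wheel_rot n) {to_hub v, rim_fwd v, rim_bwd v}"
    proof (rule cyclic_onI)
      fix T x assume T: "wheel_rot n (to_hub v) \<in> T" "\<And>x. x \<in> T \<Longrightarrow> wheel_rot n x \<in> T"
        and x: "x \<in> {to_hub v, rim_fwd v, rim_bwd v}"
      have "rim_fwd v \<in> T" using T(1) v by simp
      moreover from T(2)[OF this] have "rim_bwd v \<in> T" using v by simp
      moreover from T(2)[OF this] have "to_hub v \<in> T" using v by simp
      ultimately show "x \<in> T" using x by auto
    qed (use v in auto)
    then show ?thesis using wheel_out_arcs(2)[OF v] by simp
  qed
  ultimately show ?thesis
    using wheel_rot_permutes n by (auto simp: embedded_graph_def lessThan_empty_iff bot_nat_def)
qed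

lemma wheel_simple:
  assumes n: "n \<ge> 3" shows "graph (skel (wheel n))"
proof -
  interpret embedded "wheel n" by unfold_locales (rule wheel_embedded[OF n])
  have neq: "next_rim n i \<noteq> i" "prev_rim n i \<noteq> i" "next_rim n i \<noteq> prev_rim n i"
    "i \<noteq> next_rim n i" "i \<noteq> prev_rim n i" "prev_rim n i \<noteq> next_rim n i"
    "next_rim n i \<noteq> n" "prev_rim n i \<noteq> n" "n \<noteq> next_rim n i" "n \<noteq> prev_rim n i" if "i < n" for i
    using next_rim_neq[OF that n] next_rim_simps(1,2)[OF that] by auto
  show ?thesis
  proof unfold_locales
    fix e assume "e \<in> earcs (wheel n)"
    then have "e < 4 * n" by simp
    then show "etail (wheel n) e \<noteq> ehead (wheel n) e"
      by (rule wheel_arc_cases) (use neq in auto)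
  next
    fix a b assume "a \<in> earcs (wheel n)" "b \<in> earcs (wheel n)"
      and eq: "arc_to_ends (skel (wheel n)) a = arc_to_ends (skel (wheel n)) b"
    then have "a < 4 * n" "b < 4 * n" by simp_all
    then show "a = b"
      by (elim wheel_arc_cases) (use neq eq in \<open>auto simp: arc_to_ends_def\<close>)
  qed
qed

text \<open>
  One face runs along the rim backwards. The other walk goes out along a spoke \<open>i\<close>, along the rim to
  \<open>i + 1\<close>, back to the hub and out again along the spoke \<open>i + 2\<close>. As \<open>n\<close> is odd, it uses all spokes
  before it closes up: first the even ones, then, from \<open>2 * g\<close> on to \<open>1\<close>, the odd ones.
\<close>

lemma card_faces_wheel:
  assumes n: "n = 2 * g + 1" "g \<ge> 1"
  shows "card (faces (wheel n)) = 2"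
proof -
  have n3: "n \<ge> 3" using n by simp
  interpret embedded "wheel n" by unfold_locales (rule wheel_embedded[OF n3])
  let ?\<phi> = "face_succ (wheel n)"
  have step: "?\<phi> (to_rim i) = rim_fwd i" "?\<phi> (rim_fwd i) = to_hub (next_rim n i)"
    "?\<phi> (to_hub i) = to_rim (next_rim n i)" "?\<phi> (rim_bwd i) = rim_bwd (prev_rim n i)" if "i < n" for i
    using that by (simp_all add: face_succ_def)
  let ?A = "orbit ?\<phi> (to_rim 0)" and ?B = "orbit ?\<phi> (rim_bwd 0)"
  have A: "?\<phi> x \<in> ?A" if "x \<in> ?A" for x using that by (rule orbit.step)
  have B: "?\<phi> x \<in> ?B" if "x \<in> ?B" for x using that by (rule orbit.step)
  \<comment> \<open>Three steps of the facial walk lead from one outgoing spoke to the one after the next.\<close>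
  have two: "to_rim (next_rim n (next_rim n i)) \<in> ?A" if "to_rim i \<in> ?A" "i < n" for i
    using A[OF A[OF A[OF that(1)]]] that(2) by (simp add: step)
  have even: "to_rim (2 * j) \<in> ?A" if "j \<le> g" for j
    using that
  proof (induct j)
    case (Suc j)
    then show ?case using two[of "2 * j"] n by (simp add: next_rim_def)
  qed (simp add: in_own_face)
  have odd: "to_rim (2 * j + 1) \<in> ?A" if "j < g" for j
    using that
  proof (induct j)
    case 0
    then show ?case using two[OF even[of g]] n by (simp add: next_rim_def)
  next
    case (Suc j)
    then show ?case using two[of "2 * j + 1"] n by (simp add: next_rim_def)
  qed
  have rim: "to_rim i \<in> ?A" if "i < n" for i
  proof (cases "even i")
    case True
    then show ?thesis using that even[of "i div 2"] n by auto
  next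
    case False
    then show ?thesis using that odd[of "i div 2"] n by (auto elim: oddE)
  qed
  have rim_fwd: "rim_fwd i \<in> ?A" if "i < n" for i
    using A[OF rim[OF that]] that by (simp add: step)
  have hub: "to_hub i \<in> ?A" if "i < n" for i
    using A[OF rim_fwd[of "prev_rim n i"]] that by (simp add: step)
  have back0: "rim_bwd (n - Suc j) \<in> ?B" if "j < n" for j
    using that
  proof (induct j)
    case 0
    then show ?case using B[OF in_own_face] step(4)[of 0] by (simp add: prev_rim_def)
  next
    case (Suc j)
    then have "prev_rim n (n - Suc j) = n - Suc (Suc j)" by (auto simp: prev_rim_def)
    then show ?case using Suc B[of "rim_bwd (n - Suc j)"] step(4)[of "n - Suc j"] by simp
  qed
  have rim_bwd: "rim_bwd i \<in> ?B" if "i < n" for i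
    using back0[of "n - Suc i"] that by simp
  have "\<exists>i < n. x = rim_bwd i" if "x \<in> ?B" for x
    using that n3 by induct (auto simp: step)
  then have "?A \<noteq> ?B" using in_own_face[of "to_rim 0"] by force
  have "?A \<in> faces (wheel n)" "?B \<in> faces (wheel n)" using n3 by (auto simp: faces_def)
  have "orbit ?\<phi> a \<in> {?A, ?B}" if "a < 4 * n" for a
  proof -
    have "a \<in> ?A \<or> a \<in> ?B"
      using that by (rule wheel_arc_cases) (use rim rim_fwd hub rim_bwd in blast)+
    then show ?thesis
      unfolding in_face_iff[OF \<open>?A \<in> faces _\<close>] in_face_iff[OF \<open>?B \<in> faces _\<close>] by blast
  qed
  then have "faces (wheel n) = {?A, ?B}"
    using \<open>?A \<in> faces _\<close> \<open>?B \<in> faces _\<close> by (auto simp: faces_def)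
  then show ?thesis using \<open>?A \<noteq> ?B\<close> by simp
qed

lemma genus_wheel:
  assumes "n = 2 * g + 1" "g \<ge> 1"
  shows "genus (wheel n) = real g"
proof -
  have n3: "n \<ge> 3" using assms by simp
  interpret embedded "wheel n" by unfold_locales (rule wheel_embedded[OF n3])
  show ?thesis
    using card_arcs card_faces_wheel[OF assms] assms by (simp add: genus_def)
qed

section \<open>Edge-breaking operations destroy 3-connectivity\<close>

theorem theorem2:
  fixes Op :: "('w, 'b) lopsp" and g :: nat
  assumes "lopsp_operation Op"
    and "c3 Op"
    and "edge_breaking Op"
    and "g \<ge> 1"
  shows "\<exists>G :: (nat, nat) emb.
           embedded_graph G \<and> graph (skel G) \<and> k_connected 3 (skel G) \<and>
           genus G = real g \<and>
           \<not> k_connected 3 (skel (lopsp_apply Op G))"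
proof (intro exI conjI)
  define n where "n = 2 * g + 1"
  have n: "n \<ge> 3" using assms(4) by (simp add: n_def)
  let ?G = "wheel n"
  show emb: "embedded_graph ?G" using n by (rule wheel_embedded)
  show "graph (skel ?G)" using n by (rule wheel_simple)
  show "k_connected 3 (skel ?G)" using n by (rule wheel_3_connected)
  show "genus ?G = real g" using n_def assms(4) by (rule genus_wheel)
  obtain c where c: "c \<in> earcs (patch Op)" "etail (patch Op) c = sv1 Op"
    "ehead (patch Op) c = sv2 Op" and t: "vtype Op (sv2 Op) = 0"
    using assms(3) by (auto simp: edge_breaking_def elim: reachableE)
  interpret edge_breaking_gluing Op ?G "SOME P. cut_path Op P" c
    using assms(1) emb c t someI_ex[OF ex_cut_path[OF assms(1)]]
    by unfold_locales (auto simp: lopsp_operation_def Let_def)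
  have "card (faces ?G) \<le> 2" using card_faces_wheel[OF n_def assms(4)] by simp
  moreover have "to_rim 0 \<in> earcs ?G" "etail ?G (to_rim 0) \<noteq> ehead ?G (to_rim 0)"
    using n by auto
  ultimately show "\<not> k_connected 3 (skel (lopsp_apply Op ?G))"
    unfolding lopsp_apply_def by (rule not_3_connected)
qed

end
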